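(* Let $\mathcal{A}$ be a central essential arrangement in $V=\mathbb{C}^\ell$. For every $p$, the coherent sheaf on $\mathbb{P}V$ associated with the graded module $\Omega^p_0(\mathcal{A})$ is the sheaf of logarithmic $p$-forms along $\mathbb{P}\mathcal{A}$: $$\widetilde{\Omega^p_0(\mathcal{A})}=\Omega^p(\mathbb{P}\mathcal{A}).$$
   Context: $\mathcal{A}$ is a finite set of distinct linear hyperplanes in $V=\mathbb{C}^\ell$ with common intersection $\{0\}$; $R=\operatorname{Sym}(V^* )=\mathbb{C}[x_1,\dots,x_\ell]$; each $H\in\mathcal{A}$ is the kernel of a linear form $\alpha_H$, and $f=\prod_{H\in\mathcal{A}}\alpha_H$. $\Omega^p_V$ is the module of polynomial $p$-forms on $V$, graded so that $d:R\to\Omega^1_V$ has degree $0$ (so $dx_i$ has degree $1$), and $$\Omega^p(\mathcal{A})=\Big\{\omega\in\tfrac1f\Omega^p_V\ \Big|\ \forall H\in\mathcal{A}:\ \tfrac{d\alpha_H}{\alpha_H}\wedge\omega\in\tfrac1f\Omega^{p+1}_V\Big\},$$ a graded $R$-module. With $\chi=\sum_ix_i\partial_i$ the Euler vector field, $\Omega^p_0(\mathcal{A})=\ker(\iota_\chi:\Omega^p(\mathcal{A})\to\Omega^{p-1}(\mathcal{A}))$. $\mathbb{P}\mathcal{A}$ is the image of $\mathcal{A}$ in $\mathbb{P}V=\mathbb{P}^{\ell-1}$, viewed as the divisor $D=\bigcup_{H}\mathbb{P}H$ (defined by $f$), and $\Omega^p(\mathbb{P}\mathcal{A})=\Omega^p_{\mathbb{P}V}(D)\cap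 d^{-1}\Omega^{p+1}_{\mathbb{P}V}(D)$ is the sheaf of rational $p$-forms $\omega$ on $\mathbb{P}V$ such that $\omega$ and $d\omega$ have at most a simple pole along $D$. *)

theory Defs
  imports "HOL-Analysis.Analysis" "HOL-Library.Poly_Mapping" "HOL-Library.Function_Algebras"
    "HOL-Computational_Algebra.Fraction_Field"
begin

section \<open>Polynomials and rational functions on \<open>V = \<complex>\<^sup>\<ell>\<close>\<close>

text \<open>
  The coordinates \<open>x\<^sub>i\<close> of \<open>V\<close> are indexed by a finite type \<open>'n\<close>, so \<open>\<ell> = CARD('n)\<close> and
  \<open>V = complex^'n\<close>. A linear order on \<open>'n\<close> is needed for the signs of the exterior algebra
  (and for the instance \<open>idom\<close> of the polynomial ring).
\<close>

type_synonym 'n cpoly = "('n \<Rightarrow>\<^sub>0 nat) \<Rightarrow>\<^sub>0 complex"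
type_synonym 'n crat = "'n cpoly fract"
type_synonym 'n cspace = "(complex, 'n) vec"

abbreviation rat_of_poly :: "'n::{finite,linorder} cpoly \<Rightarrow> 'n crat" where
  "rat_of_poly a \<equiv> Fract a 1"

definition poly_X :: "'n \<Rightarrow> 'n cpoly" where
  "poly_X i = Poly_Mapping.single (Poly_Mapping.single i 1) 1"

definition rat_X :: "'n::{finite,linorder} \<Rightarrow> 'n crat" where
  "rat_X i = rat_of_poly (poly_X i)"

definition poly_eval :: "'n::finite cpoly \<Rightarrow> 'n cspace \<Rightarrow> complex" where
  "poly_eval a v = (\<Sum>m\<in>Poly_Mapping.keys a.
     Poly_Mapping.lookup a m * (\<Prod>i\<in>UNIV. (v $ i) ^ Poly_Mapping.lookup m i))"

definition homogeneous_poly :: "nat \<Rightarrow> 'n::finite cpoly \<Rightarrow> bool" where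
  "homogeneous_poly d a \<longleftrightarrow>
     (\<forall>m\<in>Poly_Mapping.keys a. (\<Sum>i\<in>UNIV. Poly_Mapping.lookup m i) = d)"

definition homogeneous_rat :: "int \<Rightarrow> 'n::{finite,linorder} crat \<Rightarrow> bool" where
  "homogeneous_rat k g \<longleftrightarrow> (\<exists>a b d e. homogeneous_poly d a \<and> homogeneous_poly e b \<and> b \<noteq> 0 \<and>
     int d - int e = k \<and> g = Fract a b)"

definition poly_pderiv :: "'n \<Rightarrow> 'n cpoly \<Rightarrow> 'n cpoly" where
  "poly_pderiv i a = (\<Sum>m\<in>Poly_Mapping.keys a. Poly_Mapping.single (m - Poly_Mapping.single i 1)
     (of_nat (Poly_Mapping.lookup m i) * Poly_Mapping.lookup a m))"

lemma poly_pderiv_superset: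
  assumes "finite S" "Poly_Mapping.keys a \<subseteq> S"
  shows "poly_pderiv i a = (\<Sum>m\<in>S. Poly_Mapping.single (m - Poly_Mapping.single i 1)
     (of_nat (Poly_Mapping.lookup m i) * Poly_Mapping.lookup a m))"
  unfolding poly_pderiv_def
  by (rule sum.mono_neutral_left) (use assms in \<open>auto simp: in_keys_iff\<close>)

lemma poly_pderiv_zero [simp]: "poly_pderiv i 0 = 0"
  by (simp add: poly_pderiv_def)

lemma poly_pderiv_single:
  "poly_pderiv i (Poly_Mapping.single m c) =
     Poly_Mapping.single (m - Poly_Mapping.single i 1) (of_nat (Poly_Mapping.lookup m i) * c)"
  by (subst poly_pderiv_superset[where S = "{m}"]) auto

lemma poly_pderiv_add: "poly_pderiv i (a + b) = poly_pderiv i a + poly_pderiv i b"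
proof -
  let ?S = "Poly_Mapping.keys a \<union> Poly_Mapping.keys b"
  have fin: "finite ?S" by simp
  show ?thesis
    using poly_pderiv_superset[OF fin, of a i] poly_pderiv_superset[OF fin, of b i]
      poly_pderiv_superset[OF fin, of "a + b" i] Poly_Mapping.keys_add[of a b]
    by (simp add: sum.distrib[symmetric] lookup_add distrib_left single_add)
qed

lemma poly_pderiv_sum: "poly_pderiv i (sum g S) = (\<Sum>x\<in>S. poly_pderiv i (g x))"
  by (induction S rule: infinite_finite_induct) (auto simp: poly_pderiv_add)

lemma poly_pderiv_mult_single:
  fixes m n :: "'n \<Rightarrow>\<^sub>0 nat"
  shows "poly_pderiv i (Poly_Mapping.single m c * Poly_Mapping.single n d) =
    poly_pderiv i (Poly_Mapping.single m c) * Poly_Mapping.single n d +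
    Poly_Mapping.single m c * poly_pderiv i (Poly_Mapping.single n d)"
proof -
  let ?e = "Poly_Mapping.single i (1::nat)"
  have shift: "u - ?e + v = u + v - ?e" if "Poly_Mapping.lookup u i \<noteq> 0"
    for u v :: "'n \<Rightarrow>\<^sub>0 nat"
    using that
    by (intro poly_mapping_eqI)
       (auto simp: lookup_add lookup_minus lookup_single when_def)
  have l: "poly_pderiv i (Poly_Mapping.single m c) * Poly_Mapping.single n d =
      Poly_Mapping.single (m + n - ?e) (of_nat (Poly_Mapping.lookup m i) * (c * d))"
    using shift[of m n]
    by (cases "Poly_Mapping.lookup m i = 0")
       (simp_all add: poly_pderiv_single mult_single mult.assoc)
  have r: "Poly_Mapping.single m c * poly_pderiv i (Poly_Mapping.single n d) =
      Poly_Mapping.single (m + n - ?e) (of_nat (Poly_Mapping.lookup n i) * (c * d))"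
    using shift[of n m]
    by (cases "Poly_Mapping.lookup n i = 0")
       (simp_all add: poly_pderiv_single mult_single mult.left_commute add.commute[of m])
  show ?thesis
    unfolding l r
    by (simp add: mult_single poly_pderiv_single lookup_add single_add[symmetric] distrib_right)
qed

lemma poly_sum_monomials:
  "(a :: 'n cpoly) = (\<Sum>m\<in>Poly_Mapping.keys a. Poly_Mapping.single m (Poly_Mapping.lookup a m))"
  by (intro poly_mapping_eqI) (auto simp: lookup_sum lookup_single when_def in_keys_iff)

lemma poly_pderiv_mult: "poly_pderiv i (a * b) = poly_pderiv i a * b + a * poly_pderiv i b"
proof -
  define s where "s x m = Poly_Mapping.single m (Poly_Mapping.lookup x m)"
    for x :: "'a cpoly" and m
  let ?K = "Poly_Mapping.keys a" and ?L = "Poly_Mapping.keys b"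
  have a: "a = sum (s a) ?K" and b: "b = sum (s b) ?L"
    using poly_sum_monomials unfolding s_def by auto
  have da: "poly_pderiv i a = (\<Sum>m\<in>?K. poly_pderiv i (s a m))"
    by (subst a) (simp add: poly_pderiv_sum)
  have db: "poly_pderiv i b = (\<Sum>m\<in>?L. poly_pderiv i (s b m))"
    by (subst b) (simp add: poly_pderiv_sum)
  have "a * b = (\<Sum>m\<in>?K. \<Sum>n\<in>?L. s a m * s b n)"
    by (subst a, subst b) (simp add: sum_product)
  then have "poly_pderiv i (a * b) =
      (\<Sum>m\<in>?K. \<Sum>n\<in>?L. poly_pderiv i (s a m) * s b n + s a m * poly_pderiv i (s b n))"
    by (simp add: poly_pderiv_sum poly_pderiv_mult_single s_def)
  also have "\<dots> = (\<Sum>m\<in>?K. poly_pderiv i (s a m)) * sum (s b) ?L +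
      sum (s a) ?K * (\<Sum>n\<in>?L. poly_pderiv i (s b n))"
    by (simp add: sum.distrib sum_product)
  finally show ?thesis
    using a b da db by simp
qed

lift_definition rat_pderiv :: "'n::{finite,linorder} \<Rightarrow> 'n crat \<Rightarrow> 'n crat" is
  "\<lambda>i g. (poly_pderiv i (fst g) * snd g - fst g * poly_pderiv i (snd g), snd g * snd g)"
proof -
  fix i :: 'n and g h :: "'n cpoly \<times> 'n cpoly"
  assume gh: "fractrel g h"
  obtain a b c e where [simp]: "g = (a, b)" "h = (c, e)"
    by (cases g, cases h)
  have ne: "b \<noteq> 0" "e \<noteq> 0" and eq: "a * e = c * b"
    using gh by (auto simp: fractrel_def)
  let ?D = "poly_pderiv i"
  have D: "?D a * e + a * ?D e = ?D c * b + c * ?D b"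
    using eq by (metis poly_pderiv_mult)
  have "(?D a * b - a * ?D b) * (e * e) =
      (?D a * e + a * ?D e) * b * e - (a * e) * (b * ?D e) - (a * e) * (e * ?D b)"
    by (simp add: algebra_simps)
  also have "\<dots> = (?D c * b + c * ?D b) * b * e - (c * b) * (b * ?D e) - (c * b) * (e * ?D b)"
    by (simp only: D eq)
  also have "\<dots> = (?D c * e - c * ?D e) * (b * b)"
    by (simp add: algebra_simps)
  finally show "fractrel (?D (fst g) * snd g - fst g * ?D (snd g), snd g * snd g)
      (?D (fst h) * snd h - fst h * ?D (snd h), snd h * snd h)"
    using ne by (simp add: fractrel_def)
qed

section \<open>Exterior algebra over the field of rational functions\<close>

text \<open>
  Given coframe elements \<open>e\<^sub>i\<close> (\<open>i :: 'n\<close>), a form is encoded by its coefficients: \<open>\<omega>\<close> stands for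
  \<open>\<Sum>\<^sub>I \<omega> I \<cdot> e\<^sub>I\<close>, where \<open>e\<^sub>I = e\<^bsub>i\<^sub>1\<^esub> \<and> \<dots> \<and> e\<^bsub>i\<^sub>p\<^esub>\<close> for \<open>I = {i\<^sub>1 < \<dots> < i\<^sub>p}\<close>. On \<open>V\<close> we use
  \<open>e\<^sub>i = dx\<^sub>i\<close>; on the chart \<open>x\<^sub>k \<noteq> 0\<close> of \<open>\<P>V\<close> we use \<open>e\<^sub>i = d(x\<^sub>i/x\<^sub>k)\<close> for \<open>i \<noteq> k\<close>, with all
  coefficients at index sets containing \<open>k\<close> equal to zero. Forms are added pointwise.
\<close>

type_synonym 'n form = "'n set \<Rightarrow> 'n crat"

definition scale_form :: "'n::{finite,linorder} crat \<Rightarrow> 'n form \<Rightarrow> 'n form" where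
  "scale_form c \<omega> = (\<lambda>I. c * \<omega> I)"

definition function_form :: "'n::{finite,linorder} crat \<Rightarrow> 'n form" where
  "function_form g = (\<lambda>I. if I = {} then g else 0)"

definition wedge :: "'n::{finite,linorder} form \<Rightarrow> 'n form \<Rightarrow> 'n form" (infixr \<open>\<and>\<^sub>f\<close> 70) where
  "\<omega> \<and>\<^sub>f \<eta> = (\<lambda>I. \<Sum>J\<in>Pow I.
     (-1) ^ card {(a, b). a \<in> J \<and> b \<in> I - J \<and> b < a} * \<omega> J * \<eta> (I - J))"

definition sign_at :: "'n::{finite,linorder} \<Rightarrow> 'n set \<Rightarrow> 'n crat" where
  "sign_at i I = (-1) ^ card {k\<in>I. k < i}"

text \<open>
  Exterior derivative \<open>d(\<Sum>\<^sub>I \<omega> I \<cdot> e\<^sub>I) = \<Sum>\<^sub>I \<Sum>\<^sub>i D i (\<omega> I) \<cdot> e\<^sub>i \<and> e\<^sub>I\<close>, where \<open>D\<close> is the family of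
  derivations dual to a coframe of closed forms \<open>e\<^sub>i\<close>.
\<close>

definition ext_deriv ::
  "('n::{finite,linorder} \<Rightarrow> 'n crat \<Rightarrow> 'n crat) \<Rightarrow> 'n form \<Rightarrow> 'n form" where
  "ext_deriv D \<omega> = (\<lambda>I. \<Sum>i\<in>I. sign_at i I * D i (\<omega> (I - {i})))"

definition differential ::
  "('n::{finite,linorder} \<Rightarrow> 'n crat \<Rightarrow> 'n crat) \<Rightarrow> 'n crat \<Rightarrow> 'n form" where
  "differential D g = ext_deriv D (function_form g)"

text \<open>
  On rational functions of degree \<open>0\<close> (that is, on the function field of \<open>\<P>V\<close>) the partial
  derivative with respect to the chart coordinate \<open>x\<^sub>i/x\<^sub>k\<close> is \<open>x\<^sub>k \<cdot> \<partial>/\<partial>x\<^sub>i\<close>.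
\<close>

definition chart_deriv :: "'n::{finite,linorder} \<Rightarrow> 'n \<Rightarrow> 'n crat \<Rightarrow> 'n crat" where
  "chart_deriv k i g = (if i = k then 0 else rat_X k * rat_pderiv i g)"

text \<open>
  Rewriting a form given in the chart \<open>x\<^sub>k \<noteq> 0\<close> in the coframe dual to \<open>D\<close>: substitute for
  \<open>d(x\<^sub>i/x\<^sub>k)\<close> the differential of the function \<open>x\<^sub>i/x\<^sub>k\<close> as computed by \<open>D\<close>.
\<close>

definition chart_monomial ::
  "('n::{finite,linorder} \<Rightarrow> 'n crat \<Rightarrow> 'n crat) \<Rightarrow> 'n \<Rightarrow> 'n set \<Rightarrow> 'n form" where
  "chart_monomial D k I =
     foldr (\<lambda>i \<eta>. differential D (rat_X i / rat_X k) \<and>\<^sub>f \<eta>) (sorted_list_of_set I)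
       (function_form 1)"

definition change_coframe ::
  "('n::{finite,linorder} \<Rightarrow> 'n crat \<Rightarrow> 'n crat) \<Rightarrow> 'n \<Rightarrow> 'n form \<Rightarrow> 'n form" where
  "change_coframe D k \<omega> = (\<Sum>I\<in>UNIV. scale_form (\<omega> I) (chart_monomial D k I))"

section \<open>Arrangements and logarithmic forms on \<open>V\<close>\<close>

definition linear_hyperplane :: "'n::finite cspace set \<Rightarrow> bool" where
  "linear_hyperplane H \<longleftrightarrow> vec.subspace H \<and> vec.dim H + 1 = CARD('n)"

definition central_essential_arrangement :: "'n::finite cspace set set \<Rightarrow> bool" where
  "central_essential_arrangement A \<longleftrightarrow>
     finite A \<and> (\<forall>H\<in>A. linear_hyperplane H) \<and> \<Inter>A = {0}"

definition defining_forms ::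
  "'n::finite cspace set set \<Rightarrow> ('n cspace set \<Rightarrow> 'n cpoly) \<Rightarrow> bool" where
  "defining_forms A \<alpha> \<longleftrightarrow>
     (\<forall>H\<in>A. homogeneous_poly 1 (\<alpha> H) \<and> H = {v. poly_eval (\<alpha> H) v = 0})"

definition defining_poly ::
  "'n::{finite,linorder} cspace set set \<Rightarrow> ('n cspace set \<Rightarrow> 'n cpoly) \<Rightarrow> 'n cpoly" where
  "defining_poly A \<alpha> = (\<Prod>H\<in>A. \<alpha> H)"

definition poly_forms :: "nat \<Rightarrow> 'n::{finite,linorder} form set" where
  "poly_forms p =
     {\<omega>. \<forall>I. \<omega> I \<in> range rat_of_poly \<and> (card I \<noteq> p \<longrightarrow> \<omega> I = 0)}"

definition poly_forms_over :: "'n::{finite,linorder} cpoly \<Rightarrow> nat \<Rightarrow> 'n form set" where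
  "poly_forms_over f p = scale_form (inverse (rat_of_poly f)) ` poly_forms p"

definition log_forms ::
  "'n::{finite,linorder} cspace set set \<Rightarrow> ('n cspace set \<Rightarrow> 'n cpoly) \<Rightarrow> nat \<Rightarrow> 'n form set"
  where
  "log_forms A \<alpha> p = {\<omega> \<in> poly_forms_over (defining_poly A \<alpha>) p.
     \<forall>H\<in>A. scale_form (inverse (rat_of_poly (\<alpha> H))) (differential rat_pderiv (rat_of_poly (\<alpha> H)))
         \<and>\<^sub>f \<omega> \<in> poly_forms_over (defining_poly A \<alpha>) (p + 1)}"

definition euler_contraction :: "'n::{finite,linorder} form \<Rightarrow> 'n form" where
  "euler_contraction \<omega> = (\<lambda>I. \<Sum>i\<in>-I. sign_at i I * rat_X i * \<omega> (insert i I))"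

definition log_forms0 ::
  "'n::{finite,linorder} cspace set set \<Rightarrow> ('n cspace set \<Rightarrow> 'n cpoly) \<Rightarrow> nat \<Rightarrow> 'n form set"
  where
  "log_forms0 A \<alpha> p = {\<omega> \<in> log_forms A \<alpha> p. euler_contraction \<omega> = 0}"

text \<open>The grading in which each \<open>dx\<^sub>i\<close> has degree \<open>1\<close>.\<close>

definition log_forms0_deg ::
  "'n::{finite,linorder} cspace set set \<Rightarrow> ('n cspace set \<Rightarrow> 'n cpoly) \<Rightarrow> nat \<Rightarrow> int
     \<Rightarrow> 'n form set" where
  "log_forms0_deg A \<alpha> p k =
     {\<omega> \<in> log_forms0 A \<alpha> p. \<forall>I. homogeneous_rat (k - int (card I)) (\<omega> I)}"

section \<open>Projective space and sheaves on it\<close>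

text \<open>The (closed) points of \<open>\<P>V\<close> are the lines through the origin.\<close>

type_synonym 'n ppoint = "'n cspace set"

definition proj_space :: "'n::finite ppoint set" where
  "proj_space = {q. vec.subspace q \<and> vec.dim q = 1}"

text \<open>For homogeneous polynomials the following does not depend on the chosen vector of the line.\<close>

definition vanishes_at :: "'n::finite cpoly \<Rightarrow> 'n ppoint \<Rightarrow> bool" where
  "vanishes_at a q \<longleftrightarrow> (\<forall>v\<in>q - {0}. poly_eval a v = 0)"

definition zariski_open :: "'n::finite ppoint set \<Rightarrow> bool" where
  "zariski_open U \<longleftrightarrow> (\<exists>S. (\<forall>a\<in>S. \<exists>d. homogeneous_poly d a) \<and>
     U = {q \<in> proj_space. \<exists>a\<in>S. \<not> vanishes_at a q})"

definition local_ring :: "'n::{finite,linorder} ppoint \<Rightarrow> 'n crat set" where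
  "local_ring q = {Fract a b |a b d. homogeneous_poly d a \<and> homogeneous_poly d b \<and>
     \<not> vanishes_at b q}"

text \<open>
  A sheaf is given by its sets of sections; the sections over \<open>U\<close> are functions on \<open>U\<close> assigning
  to each point a germ there, and restriction of sections is restriction of functions.

  The sheaf associated with a graded module \<open>M\<close>, with homogeneous parts \<open>G k\<close>, is the usual one:
  a section over \<open>U\<close> assigns to \<open>q \<in> U\<close> an element of the degree \<open>0\<close> part of the homogeneous
  localization of \<open>M\<close> at \<open>q\<close>, and is locally a fraction \<open>m/a\<close> with \<open>m\<close>, \<open>a\<close> homogeneous of the
  same degree. Here \<open>M\<close> is always a submodule of a vector space (with scalar multiplication
  \<open>sc\<close>) over the field of rational functions, so all these localizations are contained in
  that vector space. The case \<open>M = R\<close> is the structure sheaf.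
\<close>

type_synonym ('n, 'm) sections = "'n ppoint set \<Rightarrow> ('n ppoint \<Rightarrow> 'm) set"

definition associated_sheaf ::
  "('n::{finite,linorder} crat \<Rightarrow> 'm \<Rightarrow> 'm) \<Rightarrow> (int \<Rightarrow> 'm set) \<Rightarrow> ('n, 'm) sections" where
  "associated_sheaf sc G U = {s \<in> extensional U. \<forall>q\<in>U.
     \<exists>W m a d. zariski_open W \<and> q \<in> W \<and> W \<subseteq> U \<and> m \<in> G (int d) \<and> homogeneous_poly d a \<and>
       (\<forall>q'\<in>W. \<not> vanishes_at a q' \<and> s q' = sc (inverse (rat_of_poly a)) m)}"

definition structure_sheaf :: "('n::{finite,linorder}, 'n crat) sections" where
  "structure_sheaf =
     associated_sheaf (*) (\<lambda>k. {rat_of_poly a |a d. homogeneous_poly d a \<and> int d = k})"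

definition module_sheaf_iso ::
  "('n::{finite,linorder}, 'n crat) sections \<Rightarrow>
   ('n crat \<Rightarrow> 'm \<Rightarrow> 'm) \<Rightarrow> ('n, 'm::ab_group_add) sections \<Rightarrow>
   ('n crat \<Rightarrow> 'k \<Rightarrow> 'k) \<Rightarrow> ('n, 'k::ab_group_add) sections \<Rightarrow>
   ('n ppoint set \<Rightarrow> ('n ppoint \<Rightarrow> 'm) \<Rightarrow> ('n ppoint \<Rightarrow> 'k)) \<Rightarrow> bool" where
  "module_sheaf_iso \<O> scF \<F> scG \<G> \<Phi> \<longleftrightarrow> (\<forall>U. zariski_open U \<longrightarrow>
     bij_betw (\<Phi> U) (\<F> U) (\<G> U) \<and>
     (\<forall>s\<in>\<F> U. \<forall>t\<in>\<F> U. \<Phi> U (\<lambda>q\<in>U. s q + t q) = (\<lambda>q\<in>U. \<Phi> U s q + \<Phi> U t q)) \<and>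
     (\<forall>c\<in>\<O> U. \<forall>s\<in>\<F> U. \<Phi> U (\<lambda>q\<in>U. scF (c q) (s q)) = (\<lambda>q\<in>U. scG (c q) (\<Phi> U s q))) \<and>
     (\<forall>W s. zariski_open W \<and> W \<subseteq> U \<and> s \<in> \<F> U \<longrightarrow>
        \<Phi> W (restrict s W) = restrict (\<Phi> U s) W))"

section \<open>Rational and logarithmic forms on \<open>\<P>V\<close>\<close>

text \<open>
  A rational \<open>p\<close>-form on \<open>\<P>V\<close> is a family of rational \<open>p\<close>-forms \<open>\<omega> k\<close> on the charts \<open>x\<^sub>k \<noteq> 0\<close>,
  in the coordinates \<open>x\<^sub>i/x\<^sub>k\<close> (\<open>i \<noteq> k\<close>), with coefficients in the function field of \<open>\<P>V\<close>,
  which agree under the changes of coordinates.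
\<close>

type_synonym 'n pform = "'n \<Rightarrow> 'n form"

definition rational_pforms :: "nat \<Rightarrow> 'n::{finite,linorder} pform set" where
  "rational_pforms p = {\<omega>.
     (\<forall>k I. homogeneous_rat 0 (\<omega> k I) \<and> (k \<in> I \<or> card I \<noteq> p \<longrightarrow> \<omega> k I = 0)) \<and>
     (\<forall>j k. \<omega> j = change_coframe (chart_deriv j) k (\<omega> k))}"

definition scale_pform :: "'n::{finite,linorder} crat \<Rightarrow> 'n pform \<Rightarrow> 'n pform" where
  "scale_pform c \<omega> = (\<lambda>k. scale_form c (\<omega> k))"

definition pform_deriv :: "'n::{finite,linorder} pform \<Rightarrow> 'n pform" where
  "pform_deriv \<omega> = (\<lambda>k. ext_deriv (chart_deriv k) (\<omega> k))"

text \<open>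
  At a point \<open>q\<close> of the chart \<open>x\<^sub>k \<noteq> 0\<close>, the divisor \<open>D\<close> defined by \<open>f\<close> has the local equation
  \<open>f/x\<^sub>k\<^sup>n\<close> with \<open>n = deg f = card A\<close>, and the \<open>d(x\<^sub>i/x\<^sub>k)\<close> (\<open>i \<noteq> k\<close>) freely generate the regular
  \<open>1\<close>-forms.
\<close>

definition simple_pole_at ::
  "'n::{finite,linorder} cspace set set \<Rightarrow> ('n cspace set \<Rightarrow> 'n cpoly) \<Rightarrow> 'n pform
     \<Rightarrow> 'n ppoint \<Rightarrow> bool" where
  "simple_pole_at A \<alpha> \<omega> q \<longleftrightarrow> (\<forall>k. \<not> vanishes_at (poly_X k) q \<longrightarrow>
     (\<forall>I. Fract (defining_poly A \<alpha>) (poly_X k ^ card A) * \<omega> k I \<in> local_ring q))"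

text \<open>
  Sections of the sheaf of rational \<open>p\<close>-forms are locally constant functions with values in the
  rational \<open>p\<close>-forms; for nonempty \<open>U\<close> they are constant, as \<open>\<P>V\<close> is irreducible.
\<close>

definition proj_log_sheaf ::
  "'n::{finite,linorder} cspace set set \<Rightarrow> ('n cspace set \<Rightarrow> 'n cpoly) \<Rightarrow> nat
     \<Rightarrow> ('n, 'n pform) sections" where
  "proj_log_sheaf A \<alpha> p U = {s \<in> extensional U. \<forall>q\<in>U.
     \<exists>W. \<exists>\<omega>\<in>rational_pforms p. zariski_open W \<and> q \<in> W \<and> W \<subseteq> U \<and>
       (\<forall>q'\<in>W. s q' = \<omega> \<and> simple_pole_at A \<alpha> \<omega> q' \<and> simple_pole_at A \<alpha> (pform_deriv \<omega>) q')}"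

text \<open>
  Pullback of rational forms along \<open>V - {0} \<rightarrow> \<P>V\<close>, computed in any chart. It is through this
  pullback that elements of the localizations of \<open>log_forms0 A \<alpha> p\<close> are forms on \<open>\<P>V\<close>.
\<close>

definition pullback_form :: "'n::{finite,linorder} pform \<Rightarrow> 'n form" where
  "pullback_form \<omega> = (THE \<eta>. \<forall>k. \<eta> = change_coframe rat_pderiv k (\<omega> k))"

definition pullback_sections ::
  "'n::{finite,linorder} ppoint set \<Rightarrow> ('n ppoint \<Rightarrow> 'n pform) \<Rightarrow> ('n ppoint \<Rightarrow> 'n form)" where
  "pullback_sections U s = (\<lambda>q\<in>U. pullback_form (s q))"

end

theory Submission
  imports Defs
begin

text \<open>
  Pullback along \<open>V - {0} \<rightarrow> \<P>V\<close> identifies the rational \<open>p\<close>-forms on \<open>\<P>V\<close> with the rational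
  \<open>p\<close>-forms \<open>\<eta>\<close> on \<open>V\<close> of degree \<open>0\<close> with \<open>\<iota>\<^sub>\<chi> \<eta> = 0\<close>: contraction with \<open>\<chi>\<close> determines the coefficients
  of \<open>dx\<^sub>I\<close> with \<open>k \<in> I\<close> from the others, and those are, up to powers of \<open>x\<^sub>k\<close>, the coefficients in the
  chart \<open>x\<^sub>k \<noteq> 0\<close>. So at a point \<open>q\<close> the form on \<open>\<P>V\<close> is logarithmic iff \<open>b f \<eta>\<close> and \<open>b f d\<eta>\<close> have polynomial
  coefficients off \<open>k\<close> for some homogeneous \<open>b\<close> with \<open>b(q) \<noteq> 0\<close>. Since \<open>d(f\<eta>) = df \<and> \<eta> + f d\<eta>\<close>, the
  second condition amounts to \<open>df \<and> \<eta>\<close> being regular at \<open>q\<close>, and this can be tested one hyperplane at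
  a time because the \<open>\<alpha>\<^sub>H\<close> are pairwise non-associated primes; that is the condition defining
  \<open>\<Omega>\<^sup>p(\<A>)\<close>.
\<close>

section \<open>Polynomials\<close>

text \<open>Each chart records only the coefficients at index sets without \<open>k\<close>, and the
  pole conditions at \<open>q\<close> control only these. The others come from solving the
  contraction equation for a coefficient, which divides by \<open>x_k\<close>. This is harmless
  because \<open>k\<close> is chosen with \<open>x_k\<close> nonzero at \<open>q\<close>, and it
  explains the factor \<open>poly_X k\<close> in the final denominator
  \<open>b ^ 2 * poly_X k\<close>. The square comes from the quotient rule: if \<open>b\<close>
  clears the denominators of a function, \<open>b ^ 2\<close> clears those of its derivatives. No
  transition function between charts is computed. A form killed by the contraction is determined by
  a single chart part, so compatibility of charts becomes equality of forms on V. Regularity at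
  \<open>q\<close> is handled as membership in the polynomial ring inside the function field, after
  multiplication by a homogeneous polynomial nonzero at \<open>q\<close>. Homogeneous numerators are
  recovered by cancelling homogeneous factors.\<close>

abbreviation poly_const :: "complex \<Rightarrow> 'n cpoly" where
  "poly_const c \<equiv> Poly_Mapping.single 0 c"

lemma poly_X_power: "poly_X i ^ k = Poly_Mapping.single (Poly_Mapping.single i k) 1"
  by (induction k) (auto simp: poly_X_def mult_single single_add[symmetric])

lemma prod_single_one:
  "finite S \<Longrightarrow> (\<Prod>i\<in>S. Poly_Mapping.single (f i) (1::complex)) = Poly_Mapping.single (\<Sum>i\<in>S. f i) 1"
  by (induction S rule: finite_induct) (auto simp: mult_single)

lemma sum_single_lookup:
  fixes m :: "'n::finite \<Rightarrow>\<^sub>0 nat"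
  shows "(\<Sum>i\<in>UNIV. Poly_Mapping.single i (Poly_Mapping.lookup m i)) = m"
  by (intro poly_mapping_eqI) (simp add: lookup_sum lookup_single when_def)

lemma single_eq_const_mult_prod:
  fixes m :: "'n::finite \<Rightarrow>\<^sub>0 nat"
  shows "Poly_Mapping.single m c = poly_const c * (\<Prod>i\<in>UNIV. poly_X i ^ Poly_Mapping.lookup m i)"
  by (simp add: poly_X_power prod_single_one sum_single_lookup mult_single)

text \<open>Constants and variables generate the polynomial ring, so a congruence respected by sums
  and products need only be checked on them. This serves the elimination argument for linear
  forms.\<close>

lemma cpoly_induct [case_names const X add mult]:
  fixes a :: "'n::finite cpoly"
  assumes const: "\<And>c. P (poly_const c)" and X: "\<And>i. P (poly_X i)"
    and add: "\<And>a b. P a \<Longrightarrow> P b \<Longrightarrow> P (a + b)" and mult: "\<And>a b. P a \<Longrightarrow> P b \<Longrightarrow> P (a * b)"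
  shows "P a"
proof -
  have one: "P 1"
    using const[of 1] by simp
  have pow: "P (poly_X i ^ k)" for i k
    by (induction k) (auto intro: one X mult)
  have prod: "P (\<Prod>i\<in>S. poly_X i ^ k i)" for S k
    by (induction S rule: infinite_finite_induct) (auto intro: one pow mult)
  have "P (\<Sum>m\<in>S. Poly_Mapping.single m (g m))" for S g
  proof (induction S rule: infinite_finite_induct)
    case (insert m S)
    then show ?case
      by (simp add: add mult const prod single_eq_const_mult_prod[of m])
  qed (use const[of 0] in auto)
  then show ?thesis
    using poly_sum_monomials[of a] by metis
qed

section \<open>Substitution homomorphisms: evaluation at a point and elimination of a
  variable\<close>

definition poly_subst ::
  "(complex \<Rightarrow> 'b::comm_ring_1) \<Rightarrow> ('n::finite \<Rightarrow> 'b) \<Rightarrow> 'n cpoly \<Rightarrow> 'b" where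
  "poly_subst h y a = (\<Sum>m\<in>Poly_Mapping.keys a.
     h (Poly_Mapping.lookup a m) * (\<Prod>i\<in>UNIV. y i ^ Poly_Mapping.lookup m i))"

lemma poly_eval_eq_subst: "poly_eval a v = poly_subst id (\<lambda>i. v $ i) a"
  by (simp add: poly_eval_def poly_subst_def)

locale coefficient_hom =
  fixes h :: "complex \<Rightarrow> 'b::comm_ring_1"
  assumes hom_0: "h 0 = 0" and hom_1: "h 1 = 1"
    and hom_add: "h (c + d) = h c + h d" and hom_mult: "h (c * d) = h c * h d"
begin

lemma poly_subst_superset:
  assumes "finite S" "Poly_Mapping.keys a \<subseteq> S"
  shows "poly_subst h y a =
    (\<Sum>m\<in>S. h (Poly_Mapping.lookup a m) * (\<Prod>i\<in>UNIV. y i ^ Poly_Mapping.lookup m i))"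
  unfolding poly_subst_def
  by (rule sum.mono_neutral_left) (use assms in \<open>auto simp: in_keys_iff hom_0\<close>)

lemma poly_subst_0 [simp]: "poly_subst h y 0 = 0"
  by (simp add: poly_subst_def)

lemma poly_subst_single:
  "poly_subst h y (Poly_Mapping.single m c) = h c * (\<Prod>i\<in>UNIV. y i ^ Poly_Mapping.lookup m i)"
  by (subst poly_subst_superset[where S = "{m}"]) auto

lemma poly_subst_const [simp]: "poly_subst h y (poly_const c) = h c"
  by (simp add: poly_subst_single)

lemma poly_subst_X [simp]: "poly_subst h y (poly_X i) = y i"
proof -
  have "(\<Prod>j\<in>UNIV. y j ^ Poly_Mapping.lookup (Poly_Mapping.single i 1) j) =
      (\<Prod>j\<in>UNIV. if i = j then y j else 1)"
    by (intro prod.cong) (auto simp: lookup_single when_def)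
  then show ?thesis
    by (simp add: poly_X_def poly_subst_single hom_1)
qed

lemma poly_subst_add [simp]: "poly_subst h y (a + b) = poly_subst h y a + poly_subst h y b"
proof -
  let ?S = "Poly_Mapping.keys a \<union> Poly_Mapping.keys b"
  have fin: "finite ?S" by simp
  show ?thesis
    using poly_subst_superset[OF fin, of a] poly_subst_superset[OF fin, of b]
      poly_subst_superset[OF fin, of "a + b"] Poly_Mapping.keys_add[of a b]
    by (simp add: sum.distrib[symmetric] lookup_add distrib_right hom_add)
qed

lemma poly_subst_sum [simp]: "poly_subst h y (sum g S) = (\<Sum>x\<in>S. poly_subst h y (g x))"
  by (induction S rule: infinite_finite_induct) auto

lemma poly_subst_mult [simp]: "poly_subst h y (a * b) = poly_subst h y a * poly_subst h y b"
proof -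
  define s where "s x m = Poly_Mapping.single m (Poly_Mapping.lookup x m)"
    for x :: "'a cpoly" and m
  let ?K = "Poly_Mapping.keys a" and ?L = "Poly_Mapping.keys b"
  have a: "a = sum (s a) ?K" and b: "b = sum (s b) ?L"
    using poly_sum_monomials unfolding s_def by auto
  have s: "poly_subst h y (s a m * s b n) = poly_subst h y (s a m) * poly_subst h y (s b n)" for m n
    by (simp add: s_def mult_single poly_subst_single lookup_add power_add prod.distrib hom_mult)
  have "a * b = (\<Sum>m\<in>?K. \<Sum>n\<in>?L. s a m * s b n)"
    by (subst a, subst b) (simp add: sum_product)
  then have "poly_subst h y (a * b) = poly_subst h y (sum (s a) ?K) * poly_subst h y (sum (s b) ?L)"
    by (simp add: s sum_product)
  then show ?thesis
    using a b by simp
qed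

end

interpretation id_hom: coefficient_hom id
  by unfold_locales auto

interpretation const_hom: coefficient_hom "poly_const :: complex \<Rightarrow> 'n cpoly"
  by unfold_locales (auto simp: single_add mult_single)

lemma poly_eval_mult: "poly_eval (a * b) v = poly_eval a v * poly_eval b v"
  by (simp add: poly_eval_eq_subst)

lemma poly_eval_X: "poly_eval (poly_X i) v = v $ i"
  by (simp add: poly_eval_eq_subst)

lemma poly_eval_0: "poly_eval 0 v = 0"
  by (simp add: poly_eval_eq_subst)

lemma poly_eval_1: "poly_eval 1 v = 1"
  using id_hom.poly_subst_const[of "\<lambda>i. v $ i" 1] by (simp add: poly_eval_eq_subst)

subsection \<open>Homogeneous polynomials\<close>

lemma homogeneous_poly_0 [simp]: "homogeneous_poly d 0"
  by (simp add: homogeneous_poly_def)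

lemma homogeneous_poly_const: "homogeneous_poly 0 (poly_const c)"
  by (simp add: homogeneous_poly_def)

lemma homogeneous_poly_1 [simp]: "homogeneous_poly 0 1"
  using homogeneous_poly_const[of 1] by simp

lemma homogeneous_poly_X [simp]: "homogeneous_poly 1 (poly_X i)"
  by (simp add: homogeneous_poly_def poly_X_def lookup_single when_def)

lemma homogeneous_poly_add:
  "homogeneous_poly d a \<Longrightarrow> homogeneous_poly d b \<Longrightarrow> homogeneous_poly d (a + b)"
  using Poly_Mapping.keys_add[of a b] unfolding homogeneous_poly_def by blast

lemma homogeneous_poly_uminus: "homogeneous_poly d a \<Longrightarrow> homogeneous_poly d (- a)"
  unfolding homogeneous_poly_def by (simp add: in_keys_iff)

lemma homogeneous_poly_sum:
  "(\<And>x. x \<in> S \<Longrightarrow> homogeneous_poly d (g x)) \<Longrightarrow> homogeneous_poly d (sum g S)"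
  by (induction S rule: infinite_finite_induct) (auto intro: homogeneous_poly_add)

lemma homogeneous_poly_mult:
  assumes "homogeneous_poly d a" "homogeneous_poly e b"
  shows "homogeneous_poly (d + e) (a * b)"
proof -
  have "(\<Sum>i\<in>UNIV. Poly_Mapping.lookup m i) = d + e" if m: "m \<in> Poly_Mapping.keys (a * b)" for m
  proof -
    obtain x y where "m = x + y" "x \<in> Poly_Mapping.keys a" "y \<in> Poly_Mapping.keys b"
      using keys_mult[of a b] m by auto
    then show ?thesis
      using assms by (simp add: homogeneous_poly_def lookup_add sum.distrib)
  qed
  then show ?thesis
    by (simp add: homogeneous_poly_def)
qed

lemma homogeneous_poly_power: "homogeneous_poly d a \<Longrightarrow> homogeneous_poly (k * d) (a ^ k)"
  by (induction k) (auto intro: homogeneous_poly_mult)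

lemma homogeneous_poly_prod:
  assumes "\<And>x. x \<in> S \<Longrightarrow> homogeneous_poly (d x) (g x)"
  shows "homogeneous_poly (sum d S) (prod g S)"
  using assms by (induction S rule: infinite_finite_induct) (auto intro: homogeneous_poly_mult)

lemma homogeneous_poly_X_power: "homogeneous_poly k (poly_X i ^ k)"
  using homogeneous_poly_power[OF homogeneous_poly_X, of k i] by simp

lemma homogeneous_poly_pderiv:
  assumes "homogeneous_poly d a"
  shows "poly_pderiv i a = 0 \<or> d \<ge> 1 \<and> homogeneous_poly (d - 1) (poly_pderiv i a)"
proof -
  have deg: "Poly_Mapping.lookup m i \<noteq> 0 \<longrightarrow> d \<ge> 1 \<and>
      (\<Sum>j\<in>UNIV. Poly_Mapping.lookup (m - Poly_Mapping.single i 1) j) = d - 1"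
    if "m \<in> Poly_Mapping.keys a" for m
  proof (intro impI)
    assume nz: "Poly_Mapping.lookup m i \<noteq> 0"
    have m: "m = m - Poly_Mapping.single i 1 + Poly_Mapping.single i 1"
      using nz by (intro poly_mapping_eqI) (auto simp: lookup_add lookup_minus lookup_single when_def)
    have "d = (\<Sum>j\<in>UNIV. Poly_Mapping.lookup m j)"
      using assms that by (simp add: homogeneous_poly_def)
    also have "\<dots> = (\<Sum>j\<in>UNIV. Poly_Mapping.lookup (m - Poly_Mapping.single i 1) j) + 1"
      by (subst m) (simp add: lookup_add sum.distrib lookup_single when_def)
    finally show "d \<ge> 1 \<and> (\<Sum>j\<in>UNIV. Poly_Mapping.lookup (m - Poly_Mapping.single i 1) j) = d - 1"
      by simp
  qed
  have "homogeneous_poly (d - 1) (poly_pderiv i a)"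
    unfolding poly_pderiv_def
    by (rule homogeneous_poly_sum) (use deg in \<open>auto simp: homogeneous_poly_def split: if_splits\<close>)
  moreover have "poly_pderiv i a = 0" if "d = 0"
    unfolding poly_pderiv_def by (rule sum.neutral) (use deg that in auto)
  ultimately show ?thesis
    by (cases "d = 0") auto
qed

section \<open>Homogeneous components and cancellation of homogeneous factors\<close>

definition homogeneous_component :: "nat \<Rightarrow> 'n::finite cpoly \<Rightarrow> 'n cpoly" where
  "homogeneous_component e a = (\<Sum>m\<in>Poly_Mapping.keys a.
     if (\<Sum>i\<in>UNIV. Poly_Mapping.lookup m i) = e then Poly_Mapping.single m (Poly_Mapping.lookup a m) else 0)"

lemma lookup_homogeneous_component:
  "Poly_Mapping.lookup (homogeneous_component e a) m =
     (if (\<Sum>i\<in>UNIV. Poly_Mapping.lookup m i) = e then Poly_Mapping.lookup a m else 0)"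
proof -
  have "Poly_Mapping.lookup (homogeneous_component e a) m = (\<Sum>n\<in>Poly_Mapping.keys a. if m = n then
      (if (\<Sum>i\<in>UNIV. Poly_Mapping.lookup m i) = e then Poly_Mapping.lookup a m else 0) else 0)"
    unfolding homogeneous_component_def lookup_sum
    by (intro sum.cong) (auto simp: lookup_single when_def)
  then show ?thesis
    by (simp add: in_keys_iff)
qed

lemma homogeneous_component_sum:
  "homogeneous_component e (sum g S) = (\<Sum>x\<in>S. homogeneous_component e (g x))"
  by (intro poly_mapping_eqI) (simp add: lookup_homogeneous_component lookup_sum)

lemma homogeneous_component_homogeneous:
  "homogeneous_poly d a \<Longrightarrow> homogeneous_component e a = (if d = e then a else 0)"
  by (intro poly_mapping_eqI)
    (auto simp: lookup_homogeneous_component homogeneous_poly_def in_keys_iff)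

lemma homogeneous_homogeneous_component: "homogeneous_poly e (homogeneous_component e a)"
  by (auto simp: homogeneous_poly_def in_keys_iff lookup_homogeneous_component split: if_splits)

lemma homogeneous_component_mult:
  fixes b u :: "'n::{finite,linorder} cpoly"
  assumes "homogeneous_poly d b"
  shows "homogeneous_component (d + e) (b * u) = b * homogeneous_component e u"
proof -
  define E where "E = insert e ((\<lambda>m. \<Sum>i\<in>UNIV. Poly_Mapping.lookup m i) ` Poly_Mapping.keys u)"
  have "u = (\<Sum>k\<in>E. homogeneous_component k u)"
    by (intro poly_mapping_eqI)
      (auto simp: lookup_sum lookup_homogeneous_component E_def in_keys_iff)
  then have "b * u = (\<Sum>k\<in>E. b * homogeneous_component k u)"
    by (metis sum_distrib_left)
  moreover have "homogeneous_component (d + e) (b * homogeneous_component k u) =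
      (if k = e then b * homogeneous_component e u else 0)" for k
    using homogeneous_component_homogeneous[OF homogeneous_poly_mult[OF assms
        homogeneous_homogeneous_component[of k u]], of "d + e"] by auto
  ultimately show ?thesis
    by (simp add: homogeneous_component_sum) (simp add: E_def)
qed

text \<open>A nonzero component of \<open>u\<close> in degree \<open>e\<close> yields the nonzero
  component \<open>b * homogeneous_component e u\<close> of \<open>b * u\<close> in degree
  \<open>d + e\<close>, which forces \<open>d + e = k\<close>. The case \<open>u = 0\<close> stands
  apart because it gives no information on the degrees.\<close>

lemma homogeneous_poly_mult_cancel:
  fixes b u :: "'n::{finite,linorder} cpoly"
  assumes b: "homogeneous_poly d b" "b \<noteq> 0" and bu: "homogeneous_poly k (b * u)"
  shows "u = 0 \<or> d \<le> k \<and> homogeneous_poly (k - d) u"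
proof -
  have *: "k = d + e" if "homogeneous_component e u \<noteq> 0" for e
  proof (rule ccontr)
    assume "k \<noteq> d + e"
    then have "b * homogeneous_component e u = 0"
      using homogeneous_component_mult[OF b(1), of e u] homogeneous_component_homogeneous[OF bu]
      by auto
    then show False
      using b that by simp
  qed
  have "k = d + (\<Sum>i\<in>UNIV. Poly_Mapping.lookup m i)" if "m \<in> Poly_Mapping.keys u" for m
    by (rule *) (use that in \<open>metis in_keys_iff lookup_homogeneous_component lookup_zero\<close>)
  moreover have "u \<noteq> 0 \<Longrightarrow> Poly_Mapping.keys u \<noteq> {}"
    by simp
  ultimately show ?thesis
    by (force simp: homogeneous_poly_def)
qed

lemma poly_eval_scale:
  assumes "homogeneous_poly d a"
  shows "poly_eval a (c *s v) = c ^ d * poly_eval a v"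
proof -
  have "(\<Prod>i\<in>UNIV. (c * v $ i) ^ Poly_Mapping.lookup m i) =
      c ^ d * (\<Prod>i\<in>UNIV. (v $ i) ^ Poly_Mapping.lookup m i)" if "m \<in> Poly_Mapping.keys a" for m
    using that assms
    by (simp add: power_mult_distrib prod.distrib power_sum[symmetric] homogeneous_poly_def)
  then show ?thesis
    by (simp add: poly_eval_def sum_distrib_left mult_ac)
qed

subsection \<open>Linear forms\<close>

lemma linear_form_expansion:
  fixes a :: "'n::finite cpoly"
  assumes "homogeneous_poly 1 a"
  shows "a = (\<Sum>i\<in>UNIV. poly_const (Poly_Mapping.lookup a (Poly_Mapping.single i 1)) * poly_X i)"
proof (rule poly_mapping_eqI)
  fix m :: "'n \<Rightarrow>\<^sub>0 nat"
  have *: "Poly_Mapping.lookup (poly_const c * poly_X i) m = (if m = Poly_Mapping.single i 1 then c else 0)"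
    for c i by (simp add: poly_X_def mult_single lookup_single when_def)
  show "Poly_Mapping.lookup a m = Poly_Mapping.lookup
      (\<Sum>i\<in>UNIV. poly_const (Poly_Mapping.lookup a (Poly_Mapping.single i 1)) * poly_X i) m"
  proof (cases "\<exists>j. m = Poly_Mapping.single j 1")
    case True
    then obtain j where m: "m = Poly_Mapping.single j 1" by blast
    have "Poly_Mapping.single j (1::nat) = Poly_Mapping.single i 1 \<longleftrightarrow> i = j" for i
      by (metis lookup_single_eq lookup_single_not_eq zero_neq_one)
    then show ?thesis
      unfolding lookup_sum * by (simp add: m)
  next
    case False
    have "m \<notin> Poly_Mapping.keys a"
    proof
      assume "m \<in> Poly_Mapping.keys a"
      then have 1: "(\<Sum>i\<in>UNIV. Poly_Mapping.lookup m i) = 1"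
        using assms by (simp add: homogeneous_poly_def)
      then obtain j where j: "Poly_Mapping.lookup m j = 1" "\<And>i. i \<noteq> j \<Longrightarrow> Poly_Mapping.lookup m i = 0"
        unfolding sum_eq_1_iff[OF finite] by auto
      have "m = Poly_Mapping.single j 1"
        by (intro poly_mapping_eqI) (auto simp: lookup_single when_def j)
      then show False
        using False by blast
    qed
    then show ?thesis
      using False unfolding lookup_sum * by (auto simp: in_keys_iff)
  qed
qed

lemma poly_pderiv_const [simp]: "poly_pderiv i (poly_const c) = 0"
  by (simp add: poly_pderiv_single)

lemma poly_pderiv_X: "poly_pderiv i (poly_X j) = (if i = j then 1 else 0)"
  by (simp add: poly_X_def poly_pderiv_single lookup_single when_def)

text \<open>Euler's identity in degree one. It says that contracting d\<alpha>/\<alpha> with the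
  Euler field gives 1.\<close>

lemma euler_linear_form:
  fixes a :: "'n::finite cpoly"
  assumes "homogeneous_poly 1 a"
  shows "(\<Sum>i\<in>UNIV. poly_X i * poly_pderiv i a) = a"
proof -
  let ?c = "\<lambda>j. poly_const (Poly_Mapping.lookup a (Poly_Mapping.single j 1)) :: 'n cpoly"
  have "poly_pderiv i a = ?c i" for i
  proof -
    have "poly_pderiv i a = (\<Sum>j\<in>UNIV. ?c j * poly_pderiv i (poly_X j))"
      by (subst linear_form_expansion[OF assms]) (simp add: poly_pderiv_sum poly_pderiv_mult)
    then show ?thesis
      by (simp add: poly_pderiv_X if_distrib cong: if_cong)
  qed
  then have "(\<Sum>i\<in>UNIV. poly_X i * poly_pderiv i a) = (\<Sum>i\<in>UNIV. ?c i * poly_X i)"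
    by (simp add: mult.commute)
  then show ?thesis
    using linear_form_expansion[OF assms] by metis
qed

text \<open>
  Eliminating one variable by means of the linear form \<open>a\<close> is a ring homomorphism into the
  polynomial ring whose kernel consists of the multiples of \<open>a\<close>.
\<close>

lemma prime_linear_form:
  fixes a :: "'n::{finite,linorder} cpoly"
  assumes hom: "homogeneous_poly 1 a" and nz: "a \<noteq> 0" and dvd: "a dvd b * c"
  shows "a dvd b \<or> a dvd c"
proof -
  define l where "l i = Poly_Mapping.lookup a (Poly_Mapping.single i 1)" for i
  have a: "a = (\<Sum>i\<in>UNIV. poly_const (l i) * poly_X i)"
    using linear_form_expansion[OF hom] by (simp add: l_def)
  \<comment> \<open>The pivot: the equation \<open>a = 0\<close> can be solved for the variable
    \<open>j\<close>, and \<open>y\<close> is the resulting substitution.\<close>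
  obtain j where j: "l j \<noteq> 0"
    using nz a by force
  define y where "y i = (if i = j then - poly_const (1 / l j) * (\<Sum>i\<in>UNIV - {j}. poly_const (l i) * poly_X i)
     else poly_X i)" for i
  let ?\<phi> = "poly_subst poly_const y :: 'n cpoly \<Rightarrow> 'n cpoly"
  have inv: "poly_const (l j) * poly_const (1 / l j) = (1 :: 'n cpoly)"
    using j by (simp add: mult_single)
  have split: "sum g UNIV = g j + sum g (UNIV - {j})" for g :: "'n \<Rightarrow> 'n cpoly"
    by (simp add: sum.remove[of UNIV j])
  let ?r = "\<Sum>i\<in>UNIV - {j}. poly_const (l i) * poly_X i :: 'n cpoly"
  have kill: "?\<phi> a = 0"
  proof -
    have "?\<phi> a = poly_const (l j) * y j + (\<Sum>i\<in>UNIV - {j}. poly_const (l i) * y i)"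
      by (subst a) (simp add: split)
    also have "(\<Sum>i\<in>UNIV - {j}. poly_const (l i) * y i) = ?r"
      by (intro sum.cong) (auto simp: y_def)
    also have "poly_const (l j) * y j = - (poly_const (l j) * poly_const (1 / l j)) * ?r"
      unfolding y_def by (simp add: mult.assoc)
    finally show ?thesis
      unfolding inv by simp
  qed
  have Xj: "a dvd poly_X j - y j"
  proof -
    have "poly_X j - y j = poly_const (1 / l j) * (poly_const (l j) * poly_X j + ?r)"
    proof -
      have "poly_const (1 / l j) * (poly_const (l j) * poly_X j + ?r) =
          (poly_const (l j) * poly_const (1 / l j)) * poly_X j + poly_const (1 / l j) * ?r"
        by (simp only: distrib_left mult_ac)
      then show ?thesis
        unfolding inv by (simp add: y_def)
    qed
    also have "poly_const (l j) * poly_X j + ?r = a"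
      using split[of "\<lambda>i. poly_const (l i) * poly_X i"] a by simp
    finally show ?thesis by simp
  qed
  \<comment> \<open>The substitution is the identity modulo \<open>a\<close>, because it is so on
    the generators. Hence everything it kills is a multiple of \<open>a\<close>, and primality
    follows from the absence of zero divisors in the target.\<close>
  have cong: "a dvd u - ?\<phi> u" for u
  proof (induction u rule: cpoly_induct)
    case (X i)
    then show ?case
      using Xj by (cases "i = j") (simp_all add: y_def)
  next
    case (add u v)
    then show ?case
      using dvd_add[OF add] by (simp add: algebra_simps)
  next
    case (mult u v)
    have "u * v - ?\<phi> (u * v) = (u - ?\<phi> u) * v + ?\<phi> u * (v - ?\<phi> v)"
      by (simp add: algebra_simps)
    then show ?case
      using mult by simp
  qed simp
  obtain k where k: "b * c = a * k"
    using dvd by (auto simp: dvd_def)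
  have "?\<phi> b * ?\<phi> c = ?\<phi> a * ?\<phi> k"
    by (simp only: k flip: const_hom.poly_subst_mult)
  then have "?\<phi> b = 0 \<or> ?\<phi> c = 0"
    using kill by simp
  then show ?thesis
    using cong[of b] cong[of c] by auto
qed

lemma linear_form_not_dvd_prod:
  fixes a :: "'n::{finite,linorder} cpoly"
  assumes hom: "homogeneous_poly 1 a" and nz: "a \<noteq> 0" and "finite S"
    and nd: "\<And>x. x \<in> S \<Longrightarrow> \<not> a dvd g x"
  shows "\<not> a dvd prod g S"
  using \<open>finite S\<close> nd
proof (induction S rule: finite_induct)
  case (insert x S)
  then show ?case
    using prime_linear_form[OF hom nz] by auto
next
  case empty
  show ?case
  proof
    assume "a dvd prod g {}"
    \<comment> \<open>A linear form is not a unit, since it vanishes at the origin.\<close>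
    then obtain b where "1 = a * b" by (auto simp: dvd_def)
    then have "1 = poly_eval a 0 * poly_eval b 0"
      by (metis poly_eval_1 poly_eval_mult)
    moreover have "poly_eval a 0 = 0"
      using poly_eval_scale[OF hom, of 0 0] by simp
    ultimately show False by simp
  qed
qed

section \<open>Rational functions\<close>

lemma rat_of_poly_0: "rat_of_poly 0 = 0"
  and rat_of_poly_1: "rat_of_poly 1 = 1"
  by (simp_all add: fract_collapse)

lemma rat_of_poly_add: "rat_of_poly (a + b) = rat_of_poly a + rat_of_poly b"
  and rat_of_poly_diff: "rat_of_poly (a - b) = rat_of_poly a - rat_of_poly b"
  and rat_of_poly_uminus: "rat_of_poly (- a) = - rat_of_poly a"
  and rat_of_poly_mult: "rat_of_poly (a * b) = rat_of_poly a * rat_of_poly b"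
  by simp_all

lemma rat_of_poly_sum: "rat_of_poly (sum g S) = (\<Sum>x\<in>S. rat_of_poly (g x))"
  by (induction S rule: infinite_finite_induct) (simp_all add: rat_of_poly_0 rat_of_poly_add del: add_fract)

lemma rat_of_poly_prod: "rat_of_poly (prod g S) = (\<Prod>x\<in>S. rat_of_poly (g x))"
  by (induction S rule: infinite_finite_induct) (simp_all add: rat_of_poly_1 rat_of_poly_mult del: mult_fract)

lemma rat_of_poly_power: "rat_of_poly (a ^ k) = rat_of_poly a ^ k"
  by (induction k) (simp_all add: rat_of_poly_1 rat_of_poly_mult del: mult_fract)

lemma rat_of_poly_eq_iff: "rat_of_poly a = rat_of_poly b \<longleftrightarrow> a = b"
  by (simp add: eq_fract)

lemma rat_of_poly_eq_0_iff: "rat_of_poly a = 0 \<longleftrightarrow> a = 0"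
  by (simp add: Zero_fract_def eq_fract)

lemma Fract_eq_divide: "Fract a b = rat_of_poly a / rat_of_poly b"
  by simp

lemma poly_X_nonzero [simp]: "poly_X i \<noteq> 0"
  by (metis poly_X_def lookup_single_eq lookup_zero zero_neq_one)

lemma rat_X_nonzero [simp]: "rat_X i \<noteq> 0"
  by (simp add: rat_X_def rat_of_poly_eq_0_iff)

text \<open>\<open>range rat_of_poly\<close> is the polynomial ring inside the function field. Every
  regularity claim below is membership in it, and the closure rules that start here prove these
  claims.\<close>

lemma poly_range_0 [simp]: "0 \<in> range rat_of_poly"
  and poly_range_1 [simp]: "1 \<in> range rat_of_poly"
  by (metis rat_of_poly_0 rangeI, metis rat_of_poly_1 rangeI)

lemma poly_range_add: "g \<in> range rat_of_poly \<Longrightarrow> h \<in> range rat_of_poly \<Longrightarrow> g + h \<in> range rat_of_poly"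
  by (auto simp del: add_fract simp: rat_of_poly_add[symmetric])

lemma poly_range_diff: "g \<in> range rat_of_poly \<Longrightarrow> h \<in> range rat_of_poly \<Longrightarrow> g - h \<in> range rat_of_poly"
  by (auto simp del: diff_fract simp: rat_of_poly_diff[symmetric])

lemma poly_range_mult: "g \<in> range rat_of_poly \<Longrightarrow> h \<in> range rat_of_poly \<Longrightarrow> g * h \<in> range rat_of_poly"
  by (auto simp del: mult_fract simp: rat_of_poly_mult[symmetric])

lemma poly_range_uminus: "g \<in> range rat_of_poly \<Longrightarrow> - g \<in> range rat_of_poly"
  by (auto simp del: minus_fract simp: rat_of_poly_uminus[symmetric])

lemma poly_range_power: "g \<in> range rat_of_poly \<Longrightarrow> g ^ k \<in> range rat_of_poly"
  by (auto simp: rat_of_poly_power[symmetric])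

lemma poly_range_sum: "(\<And>x. x \<in> S \<Longrightarrow> g x \<in> range rat_of_poly) \<Longrightarrow> sum g S \<in> range rat_of_poly"
  by (induction S rule: infinite_finite_induct) (auto intro!: poly_range_add)

lemma poly_range_rat_X: "rat_X i \<in> range rat_of_poly"
  by (simp add: rat_X_def)

lemma poly_range_sign_at: "sign_at i I \<in> range rat_of_poly"
  unfolding sign_at_def by (intro poly_range_power poly_range_uminus poly_range_1)

lemmas poly_range_intros = poly_range_add poly_range_diff poly_range_mult poly_range_uminus
  poly_range_power poly_range_sum poly_range_rat_X poly_range_sign_at

subsection \<open>Derivations\<close>

lemma poly_pderiv_1 [simp]: "poly_pderiv i 1 = 0"
  using poly_pderiv_const[of i 1] by simp

lemma rat_pderiv_Fract:
  "b \<noteq> 0 \<Longrightarrow> rat_pderiv i (Fract a b) = Fract (poly_pderiv i a * b - a * poly_pderiv i b) (b * b)"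
proof -
  assume b: "b \<noteq> 0"
  have Fract: "Fract a b = abs_fract (a, b)" if "b \<noteq> 0" for a b :: "'a cpoly"
    using that by (simp add: Fract_def)
  have "fractrel (a, b) (a, b)"
    using b by simp
  then show ?thesis
    using b by (simp add: Fract rat_pderiv.abs_eq)
qed

lemma rat_pderiv_poly: "rat_pderiv i (rat_of_poly a) = rat_of_poly (poly_pderiv i a)"
  by (simp add: rat_pderiv_Fract)

lemma rat_pderiv_0 [simp]: "rat_pderiv i 0 = 0"
  using rat_pderiv_poly[of i 0] by (simp add: rat_of_poly_0)

lemma rat_pderiv_1 [simp]: "rat_pderiv i 1 = 0"
  using rat_pderiv_poly[of i 1] by (simp add: rat_of_poly_0 rat_of_poly_1)

lemma rat_pderiv_mult: "rat_pderiv i (g * h) = rat_pderiv i g * h + g * rat_pderiv i h"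
  by (cases g rule: Fract_cases_nonzero; cases h rule: Fract_cases_nonzero)
    (simp_all add: rat_pderiv_Fract eq_fract poly_pderiv_mult algebra_simps)

lemma rat_pderiv_X: "rat_pderiv i (rat_X j) = (if i = j then 1 else 0)"
  by (simp add: rat_X_def rat_pderiv_poly poly_pderiv_X rat_of_poly_0 rat_of_poly_1)

lemma rat_pderiv_X_power: "i \<noteq> j \<Longrightarrow> rat_pderiv i (rat_X j ^ k) = 0"
  by (induction k) (auto simp: rat_pderiv_mult rat_pderiv_X)

lemma rat_pderiv_inverse: "g \<noteq> 0 \<Longrightarrow> rat_pderiv i (inverse g) = - rat_pderiv i g / g\<^sup>2"
proof -
  assume g: "g \<noteq> 0"
  have "rat_pderiv i g * inverse g + g * rat_pderiv i (inverse g) = 0"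
    using rat_pderiv_mult[of i g "inverse g"] g by simp
  then have "g * rat_pderiv i (inverse g) = - (rat_pderiv i g * inverse g)"
    by (simp add: eq_neg_iff_add_eq_0 add.commute)
  then show ?thesis
    using g by (simp add: field_simps power2_eq_square)
qed

lemma rat_pderiv_prod:
  assumes "finite S" "\<And>x. x \<in> S \<Longrightarrow> g x \<noteq> 0"
  shows "rat_pderiv i (prod g S) = prod g S * (\<Sum>x\<in>S. rat_pderiv i (g x) / g x)"
  using assms
  by (induction S rule: finite_induct) (auto simp: rat_pderiv_mult field_simps)

lemma poly_range_rat_pderiv: "g \<in> range rat_of_poly \<Longrightarrow> rat_pderiv i g \<in> range rat_of_poly"
  by (auto simp: rat_pderiv_poly)

text \<open>Quotient rule: differentiation at most doubles a denominator, as the product rule for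
  \<open>a * g\<close> shows after multiplication by \<open>a\<close>.\<close>

lemma poly_range_square_mult_pderiv:
  assumes "a \<in> range rat_of_poly" "a * g \<in> range rat_of_poly"
  shows "a\<^sup>2 * rat_pderiv i g \<in> range rat_of_poly"
proof -
  have "a\<^sup>2 * rat_pderiv i g = a * rat_pderiv i (a * g) - rat_pderiv i a * (a * g)"
    by (simp add: rat_pderiv_mult power2_eq_square algebra_simps)
  also have "\<dots> \<in> range rat_of_poly"
    using assms by (intro poly_range_diff poly_range_mult[OF _ poly_range_rat_pderiv]
        poly_range_mult[OF poly_range_rat_pderiv])
  finally show ?thesis .
qed

subsection \<open>Homogeneous rational functions\<close>

lemma homogeneous_ratE:
  assumes "homogeneous_rat k g"
  obtains a b d e where "homogeneous_poly d a" "homogeneous_poly e b" "b \<noteq> 0" "int d - int e = k"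
    "g = Fract a b"
  using assms unfolding homogeneous_rat_def by blast

lemma homogeneous_rat_0 [simp]: "homogeneous_rat k 0"
proof -
  \<comment> \<open>For either sign of \<open>k\<close> the difference of \<open>nat k\<close> and
    \<open>nat (- k)\<close> is \<open>k\<close>, so a power of any variable serves as denominator.
    Vanishing coefficients thus fit every degree, negative ones included.\<close>
  have "homogeneous_poly (nat k) 0 \<and> homogeneous_poly (nat (- k)) (poly_X undefined ^ nat (- k)) \<and>
      poly_X undefined ^ nat (- k) \<noteq> (0 :: 'a cpoly) \<and> int (nat k) - int (nat (- k)) = k \<and>
      0 = Fract 0 (poly_X undefined ^ nat (- k) :: 'a cpoly)"
    by (simp add: homogeneous_poly_X_power Zero_fract_def eq_fract)
  then show ?thesis
    unfolding homogeneous_rat_def by blast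
qed

lemma homogeneous_rat_poly: "homogeneous_poly d a \<Longrightarrow> homogeneous_rat (int d) (rat_of_poly a)"
  unfolding homogeneous_rat_def
  by (rule exI[of _ a], rule exI[of _ 1], rule exI[of _ d], rule exI[of _ 0]) simp

lemma homogeneous_rat_1 [simp]: "homogeneous_rat 0 1"
  using homogeneous_rat_poly[OF homogeneous_poly_1] by (simp add: rat_of_poly_1)

lemma homogeneous_rat_X: "homogeneous_rat 1 (rat_X i)"
  using homogeneous_rat_poly[OF homogeneous_poly_X[of i]] by (simp add: rat_X_def)

lemma homogeneous_rat_add:
  assumes "homogeneous_rat k g" "homogeneous_rat k h"
  shows "homogeneous_rat k (g + h)"
proof -
  obtain a b d e where g: "homogeneous_poly d a" "homogeneous_poly e b" "b \<noteq> 0" "int d - int e = k"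
      "g = Fract a b"
    using assms(1) by (rule homogeneous_ratE)
  obtain a' b' d' e' where h: "homogeneous_poly d' a'" "homogeneous_poly e' b'" "b' \<noteq> 0"
      "int d' - int e' = k" "h = Fract a' b'"
    using assms(2) by (rule homogeneous_ratE)
  have "d' + e = d + e'"
    using g(4) h(4) by linarith
  then have "homogeneous_poly (d + e') (a * b' + a' * b)"
    using homogeneous_poly_mult[OF g(1) h(2)] homogeneous_poly_mult[OF h(1) g(2)]
    by (auto intro: homogeneous_poly_add)
  moreover have "homogeneous_poly (e + e') (b * b')"
    using g h by (auto intro: homogeneous_poly_mult)
  moreover have "int (d + e') - int (e + e') = k"
    using g by simp
  ultimately show ?thesis
    using g h unfolding homogeneous_rat_def
    by (intro exI[of _ "a * b' + a' * b"] exI[of _ "b * b'"] exI[of _ "d + e'"] exI[of _ "e + e'"]) auto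
qed

lemma homogeneous_rat_mult:
  assumes "homogeneous_rat k g" "homogeneous_rat l h"
  shows "homogeneous_rat (k + l) (g * h)"
proof -
  obtain a b d e where g: "homogeneous_poly d a" "homogeneous_poly e b" "b \<noteq> 0" "int d - int e = k"
      "g = Fract a b"
    using assms(1) by (rule homogeneous_ratE)
  obtain a' b' d' e' where h: "homogeneous_poly d' a'" "homogeneous_poly e' b'" "b' \<noteq> 0"
      "int d' - int e' = l" "h = Fract a' b'"
    using assms(2) by (rule homogeneous_ratE)
  have "homogeneous_poly (d + d') (a * a') \<and> homogeneous_poly (e + e') (b * b') \<and> b * b' \<noteq> 0 \<and>
      int (d + d') - int (e + e') = k + l \<and> g * h = Fract (a * a') (b * b')"
    using g h by (auto intro: homogeneous_poly_mult)
  then show ?thesis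
    unfolding homogeneous_rat_def by blast
qed

lemma homogeneous_rat_uminus:
  assumes "homogeneous_rat k g"
  shows "homogeneous_rat k (- g)"
proof -
  obtain a b d e where g: "homogeneous_poly d a" "homogeneous_poly e b" "b \<noteq> 0" "int d - int e = k"
      "g = Fract a b"
    using assms by (rule homogeneous_ratE)
  then have "homogeneous_poly d (- a) \<and> - g = Fract (- a) b"
    by (auto intro: homogeneous_poly_uminus)
  then show ?thesis
    using g unfolding homogeneous_rat_def by blast
qed

lemma homogeneous_rat_inverse:
  assumes "homogeneous_rat k g"
  shows "homogeneous_rat (- k) (inverse g)"
proof (cases "g = 0")
  case False
  obtain a b d e where g: "homogeneous_poly d a" "homogeneous_poly e b" "b \<noteq> 0" "int d - int e = k"
      "g = Fract a b"
    using assms by (rule homogeneous_ratE)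
  have "a \<noteq> 0"
    using False g by (auto simp: fract_collapse)
  moreover have "int e - int d = - k" "inverse g = Fract b a"
    using g by auto
  ultimately show ?thesis
    using g unfolding homogeneous_rat_def by blast
qed simp

lemma homogeneous_rat_sum:
  "(\<And>x. x \<in> S \<Longrightarrow> homogeneous_rat k (g x)) \<Longrightarrow> homogeneous_rat k (sum g S)"
  by (induction S rule: infinite_finite_induct) (auto intro: homogeneous_rat_add)

lemma homogeneous_rat_X_power: "homogeneous_rat (int k) (rat_X i ^ k)"
proof -
  have "rat_X i ^ k = rat_of_poly (poly_X i ^ k)"
    by (simp add: rat_X_def rat_of_poly_power)
  then show ?thesis
    using homogeneous_rat_poly[OF homogeneous_poly_X_power] by simp
qed

lemma homogeneous_rat_sign_at: "homogeneous_rat 0 (sign_at i I)"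
proof -
  have "sign_at i I = 1 \<or> sign_at i I = - 1"
    by (simp add: sign_at_def minus_one_power_iff)
  then show ?thesis
    using homogeneous_rat_uminus[OF homogeneous_rat_1] by auto
qed

lemma homogeneous_rat_pderiv:
  assumes "homogeneous_rat k g"
  shows "homogeneous_rat (k - 1) (rat_pderiv i g)"
proof -
  \<comment> \<open>If the derivative vanishes, \<open>int d - 1\<close> may be negative. Zero is
    homogeneous of that degree as well, so both cases end in the same claim.\<close>
  have poly: "homogeneous_rat (int d - 1) (rat_of_poly (poly_pderiv i a))" if "homogeneous_poly d a" for d a
    using homogeneous_poly_pderiv[OF that, of i] homogeneous_rat_poly[of "d - 1" "poly_pderiv i a"]
    by (auto simp: rat_of_poly_0 of_nat_diff)
  obtain a b d e where g: "homogeneous_poly d a" "homogeneous_poly e b" "b \<noteq> 0" "int d - int e = k"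
      "g = Fract a b"
    using assms by (rule homogeneous_ratE)
  let ?a = "rat_of_poly a" and ?b = "rat_of_poly b"
  have b: "?b \<noteq> 0"
    using g by (simp add: rat_of_poly_eq_0_iff)
  have "rat_pderiv i g = rat_pderiv i (?a * inverse ?b)"
    using g by simp
  also have "\<dots> = rat_pderiv i ?a * inverse ?b + - (?a * (rat_pderiv i ?b * (inverse ?b * inverse ?b)))"
    unfolding rat_pderiv_mult rat_pderiv_inverse[OF b]
    using b by (simp add: field_simps power2_eq_square del: mult_fract inverse_fract divide_fract add_fract minus_fract diff_fract)
  also have "homogeneous_rat (k - 1) \<dots>"
  proof (intro homogeneous_rat_add homogeneous_rat_uminus)
    have 1: "homogeneous_rat (int d) ?a" "homogeneous_rat (- int e) (inverse ?b)"
      "homogeneous_rat (int d - 1) (rat_pderiv i ?a)" "homogeneous_rat (int e - 1) (rat_pderiv i ?b)"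
      using g poly by (auto intro!: homogeneous_rat_poly homogeneous_rat_inverse simp: rat_pderiv_poly
          simp del: inverse_fract)
    have k: "k - 1 = (int d - 1) + (- int e)" "k - 1 = int d + ((int e - 1) + (- int e + - int e))"
      using g by auto
    show "homogeneous_rat (k - 1) (rat_pderiv i ?a * inverse ?b)"
      unfolding k(1) by (intro homogeneous_rat_mult 1)
    show "homogeneous_rat (k - 1) (?a * (rat_pderiv i ?b * (inverse ?b * inverse ?b)))"
      unfolding k(2) by (intro homogeneous_rat_mult 1)
  qed
  finally show ?thesis .
qed

text \<open>The homogeneous fraction that witnesses \<open>homogeneous_rat\<close> need not be
  \<open>u / 1\<close>. Clearing it gives \<open>b * u = a\<close>, and cancelling the homogeneous
  \<open>b\<close> makes \<open>u\<close> itself homogeneous. For \<open>g = 0\<close> the bound on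
  \<open>k\<close> could fail.\<close>

lemma poly_range_homogeneous:
  assumes "g \<in> range rat_of_poly" "homogeneous_rat k g" "g \<noteq> 0"
  obtains u where "g = rat_of_poly u" "k \<ge> 0" "homogeneous_poly (nat k) u"
proof -
  obtain u where u: "g = rat_of_poly u"
    using assms(1) by auto
  obtain a b d e where g: "homogeneous_poly d a" "homogeneous_poly e b" "b \<noteq> 0" "int d - int e = k"
      "g = Fract a b"
    using assms(2) by (rule homogeneous_ratE)
  have "b * u = a"
    using u g by (simp add: eq_fract mult.commute)
  moreover have "u \<noteq> 0"
    using u assms(3) by (auto simp: rat_of_poly_0)
  ultimately have "e \<le> d" "homogeneous_poly (d - e) u"
    using homogeneous_poly_mult_cancel[OF g(2,3), of d u] g(1) by auto
  moreover have "k \<ge> 0" "nat k = d - e"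
    using g(4) \<open>e \<le> d\<close> by auto
  ultimately show ?thesis
    using that[of u] u by simp
qed

section \<open>Forms\<close>

text \<open>Left exterior multiplication by the one-form with coefficients \<theta>. The sign counts
  the factors that \<open>e_i\<close> passes on its way from the front to its place in
  \<open>I\<close>.\<close>

definition one_form_mult ::
  "('n::{finite,linorder} \<Rightarrow> 'n crat) \<Rightarrow> 'n form \<Rightarrow> 'n form" where
  "one_form_mult \<theta> \<omega> = (\<lambda>I. \<Sum>i\<in>I. sign_at i I * \<theta> i * \<omega> (I - {i}))"

lemma sum_form_apply: "sum g S I = (\<Sum>x\<in>S. g x I)"
  for g :: "'a \<Rightarrow> 'b \<Rightarrow> 'c::comm_monoid_add"
  by (induction S rule: infinite_finite_induct) auto

lemma differential_apply:
  assumes "\<And>i. D i 0 = 0"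
  shows "differential D g J = (\<Sum>i\<in>J. if J = {i} then D i g else 0)"
  unfolding differential_def ext_deriv_def
proof (intro sum.cong refl)
  fix i assume i: "i \<in> J"
  show "sign_at i J * D i (function_form g (J - {i})) = (if J = {i} then D i g else 0)"
  proof (cases "J = {i}")
    case True
    have "sign_at i {i} = 1"
      by (simp add: sign_at_def conj_commute cong: conj_cong)
    then show ?thesis
      by (simp add: True function_form_def)
  next
    case False
    then have "J - {i} \<noteq> {}"
      using i by blast
    then show ?thesis
      using False by (simp only: function_form_def if_False assms mult_zero_right)
  qed
qed

text \<open>A differential has coefficients only at singletons, so the sum over all splittings of
  \<open>I\<close> reduces to \<open>J = {i}\<close>. The inversions of that splitting are the
  elements of \<open>I\<close> below \<open>i\<close>.\<close>

lemma differential_wedge: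
  assumes "\<And>i. D i 0 = 0"
  shows "differential D g \<and>\<^sub>f \<omega> = one_form_mult (\<lambda>i. D i g) \<omega>"
proof
  fix I :: "'a set"
  have d: "differential D g {i} = D i g" for i
    using assms by (simp add: differential_apply)
  have d0: "differential D g J = 0" if "J \<notin> range (\<lambda>i. {i})" for J
    using that assms by (subst differential_apply) (auto intro!: sum.neutral)
  let ?t = "\<lambda>J. (-1) ^ card {(a, b). a \<in> J \<and> b \<in> I - J \<and> b < a} * differential D g J * \<omega> (I - J)"
  have sg: "(-1) ^ card {(a, b). a \<in> {i} \<and> b \<in> I - {i} \<and> b < a} = sign_at i I" for i
  proof -
    have "{(a, b). a \<in> {i} \<and> b \<in> I - {i} \<and> b < a} = Pair i ` {k \<in> I. k < i}"
      by auto
    then show ?thesis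
      by (simp add: sign_at_def card_image inj_on_def)
  qed
  have "(differential D g \<and>\<^sub>f \<omega>) I = (\<Sum>J\<in>Pow I. ?t J)"
    by (simp add: wedge_def)
  also have "\<dots> = (\<Sum>J\<in>(\<lambda>i. {i}) ` I. ?t J)"
    by (rule sum.mono_neutral_right) (use d0 in \<open>auto simp: image_iff\<close>)
  also have "\<dots> = (\<Sum>i\<in>I. ?t {i})"
    by (subst sum.reindex) (auto simp: inj_on_def)
  also have "\<dots> = one_form_mult (\<lambda>i. D i g) \<omega> I"
    unfolding one_form_mult_def by (intro sum.cong refl) (simp only: d sg)
  finally show "(differential D g \<and>\<^sub>f \<omega>) I = one_form_mult (\<lambda>i. D i g) \<omega> I" .
qed

lemma sign_at_square [simp]: "sign_at i I * sign_at i I = 1"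
  by (simp add: sign_at_def power_add[symmetric])

lemma sign_at_insert_self [simp]: "sign_at i (insert i I) = sign_at i I"
  by (auto simp: sign_at_def intro!: arg_cong[where f = "\<lambda>A. (-1) ^ card A"])

lemma sign_at_remove_self [simp]: "sign_at i (I - {i}) = sign_at i I"
  by (auto simp: sign_at_def intro!: arg_cong[where f = "\<lambda>A. (-1) ^ card A"])

lemma sign_at_insert:
  "j \<notin> I \<Longrightarrow> sign_at i (insert j I) = (if j < i then - sign_at i I else sign_at i I)"
proof -
  assume j: "j \<notin> I"
  have "{k \<in> insert j I. k < i} = (if j < i then insert j {k \<in> I. k < i} else {k \<in> I. k < i})"
    by auto
  then show ?thesis
    using j by (simp add: sign_at_def)
qed

text \<open>Inserting \<open>i\<close> and removing \<open>j\<close> in opposite orders differs by a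
  sign. This is what makes contraction an antiderivation.\<close>

lemma sign_at_exchange:
  assumes "j \<in> I" "i \<notin> I"
  shows "sign_at i I * sign_at j (insert i I) = - (sign_at j I * sign_at i (I - {j}))"
proof -
  define K where "K = I - {j}"
  have I: "I = insert j K" "j \<notin> K" "i \<notin> K" "i \<noteq> j"
    using assms by (auto simp: K_def)
  show ?thesis
    unfolding K_def[symmetric] using I by (auto simp: insert_commute[of i j] sign_at_insert)
qed

text \<open>Contraction is an antiderivation. The mixed terms \<open>t i j\<close>, with
  \<open>i\<close> outside and \<open>j\<close> inside \<open>I\<close>, match on both sides by the
  sign exchange. The terms that insert and remove the same index form the full sum over
  \<open>UNIV\<close>: indices outside \<open>I\<close> come from the left side, those inside from
  the contraction of \<omega>.\<close>

lemma euler_contraction_one_form_mult: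
  "euler_contraction (one_form_mult \<theta> \<omega>) I =
     (\<Sum>i\<in>UNIV. rat_X i * \<theta> i) * \<omega> I - one_form_mult \<theta> (euler_contraction \<omega>) I"
proof -
  define t where "t i j = sign_at j I * sign_at i (I - {j}) * rat_X i * \<theta> j * \<omega> (insert i (I - {j}))"
    for i j
  have "euler_contraction (one_form_mult \<theta> \<omega>) I =
      (\<Sum>i\<in>-I. rat_X i * \<theta> i * \<omega> I - (\<Sum>j\<in>I. t i j))"
    unfolding euler_contraction_def
  proof (intro sum.cong refl)
    fix i assume i: "i \<in> - I"
    then have "one_form_mult \<theta> \<omega> (insert i I) = sign_at i I * \<theta> i * \<omega> I +
        (\<Sum>j\<in>I. sign_at j (insert i I) * \<theta> j * \<omega> (insert i (I - {j})))"
      by (auto simp: one_form_mult_def insert_Diff_if intro!: sum.cong)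
    then have "sign_at i I * rat_X i * one_form_mult \<theta> \<omega> (insert i I) =
        (sign_at i I * sign_at i I) * (rat_X i * \<theta> i * \<omega> I) +
        (\<Sum>j\<in>I. (sign_at i I * sign_at j (insert i I)) * (rat_X i * \<theta> j * \<omega> (insert i (I - {j}))))"
      by (simp only: distrib_left sum_distrib_left mult_ac)
    also have "\<dots> = rat_X i * \<theta> i * \<omega> I - (\<Sum>j\<in>I. t i j)"
      using i by (simp add: sign_at_exchange t_def sum_negf[symmetric] mult_ac)
    finally show "sign_at i I * rat_X i * one_form_mult \<theta> \<omega> (insert i I) =
        rat_X i * \<theta> i * \<omega> I - (\<Sum>j\<in>I. t i j)" .
  qed
  also have "\<dots> = (\<Sum>i\<in>-I. rat_X i * \<theta> i * \<omega> I) - (\<Sum>j\<in>I. \<Sum>i\<in>-I. t i j)"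
    by (simp add: sum_subtractf sum.swap[of t])
  moreover have "one_form_mult \<theta> (euler_contraction \<omega>) I =
      (\<Sum>j\<in>I. rat_X j * \<theta> j * \<omega> I + (\<Sum>i\<in>-I. t i j))"
    unfolding one_form_mult_def
  proof (intro sum.cong refl)
    fix j assume j: "j \<in> I"
    then have "- (I - {j}) = insert j (- I)"
      by auto
    then have "euler_contraction \<omega> (I - {j}) = sign_at j I * rat_X j * \<omega> I +
        (\<Sum>i\<in>-I. sign_at i (I - {j}) * rat_X i * \<omega> (insert i (I - {j})))"
      using j by (simp add: euler_contraction_def insert_absorb)
    then have "sign_at j I * \<theta> j * euler_contraction \<omega> (I - {j}) =
        (sign_at j I * sign_at j I) * (rat_X j * \<theta> j * \<omega> I) + (\<Sum>i\<in>-I. t i j)"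
      unfolding t_def by (simp only: distrib_left sum_distrib_left mult_ac)
    then show "sign_at j I * \<theta> j * euler_contraction \<omega> (I - {j}) =
        rat_X j * \<theta> j * \<omega> I + (\<Sum>i\<in>-I. t i j)"
      by simp
  qed
  moreover have "(\<Sum>i\<in>UNIV. rat_X i * \<theta> i) * \<omega> I =
      (\<Sum>i\<in>-I. rat_X i * \<theta> i * \<omega> I) + (\<Sum>i\<in>I. rat_X i * \<theta> i * \<omega> I)"
    unfolding sum_distrib_right by (subst sum.union_disjoint[symmetric]) (auto simp: Un_commute)
  ultimately show ?thesis
    by (simp add: sum.distrib)
qed

text \<open>In the coefficient of the contraction at \<open>I - {k}\<close> only the term
  \<open>i = k\<close> involves an index set containing \<open>k\<close>. The contraction is not
  assumed zero, so that the formula also applies to d\<alpha> wedge \<nu>.\<close>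

lemma euler_contraction_solve:
  assumes "k \<in> I"
  shows "rat_X k * \<omega> I = sign_at k I * (euler_contraction \<omega> (I - {k}) -
     (\<Sum>i\<in>-I. sign_at i (I - {k}) * rat_X i * \<omega> (insert i (I - {k}))))"
proof -
  have "- (I - {k}) = insert k (- I)"
    using assms by auto
  then have "euler_contraction \<omega> (I - {k}) = sign_at k I * rat_X k * \<omega> I +
      (\<Sum>i\<in>-I. sign_at i (I - {k}) * rat_X i * \<omega> (insert i (I - {k})))"
    using assms by (simp add: euler_contraction_def insert_absorb)
  then show ?thesis
    by (simp add: mult.assoc[symmetric])
qed

subsection \<open>Forms on charts and on \<open>V\<close>\<close>

text \<open>Modulo \<open>dx_k\<close> one has \<open>dx_i = x_k d(x_i/x_k)\<close>, so each of the
  \<open>card I\<close> factors contributes one \<open>x_k\<close>.\<close>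

definition chart_part :: "'n::{finite,linorder} \<Rightarrow> 'n form \<Rightarrow> 'n form" where
  "chart_part k \<omega> = (\<lambda>I. if k \<in> I then 0 else rat_X k ^ card I * \<omega> I)"

lemma chart_part_one_form_mult:
  "chart_part k (one_form_mult \<theta> \<omega>) =
     one_form_mult (\<lambda>i. if i = k then 0 else rat_X k * \<theta> i) (chart_part k \<omega>)"
proof
  fix I
  have "rat_X k ^ card I * (sign_at i I * \<theta> i * \<omega> (I - {i})) =
      sign_at i I * (rat_X k * \<theta> i) * (rat_X k ^ card (I - {i}) * \<omega> (I - {i}))" if "i \<in> I" for i
  proof -
    have card: "card I = Suc (card (I - {i}))"
      using that by (intro card.remove) auto
    show ?thesis
      by (simp only: card power_Suc mult_ac)
  qed
  note * = this
  show "chart_part k (one_form_mult \<theta> \<omega>) I =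
      one_form_mult (\<lambda>i. if i = k then 0 else rat_X k * \<theta> i) (chart_part k \<omega>) I"
  proof (cases "k \<in> I")
    case True
    then have "(if i = k then 0 else rat_X k * \<theta> i) * chart_part k \<omega> (I - {i}) = 0" for i
      by (simp add: chart_part_def)
    then have "one_form_mult (\<lambda>i. if i = k then 0 else rat_X k * \<theta> i) (chart_part k \<omega>) I = 0"
      by (simp only: one_form_mult_def mult.assoc mult_zero_right sum.neutral_const)
    then show ?thesis
      using True by (simp add: chart_part_def)
  next
    case False
    then have "chart_part k (one_form_mult \<theta> \<omega>) I =
        (\<Sum>i\<in>I. rat_X k ^ card I * (sign_at i I * \<theta> i * \<omega> (I - {i})))"
      by (simp add: chart_part_def one_form_mult_def sum_distrib_left)
    also have "\<dots> = one_form_mult (\<lambda>i. if i = k then 0 else rat_X k * \<theta> i) (chart_part k \<omega>) I"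
      unfolding one_form_mult_def
    proof (rule sum.cong[OF refl])
      fix i assume i: "i \<in> I"
      then have "chart_part k \<omega> (I - {i}) = rat_X k ^ card (I - {i}) * \<omega> (I - {i})" "i \<noteq> k"
        using False by (auto simp: chart_part_def)
      then show "rat_X k ^ card I * (sign_at i I * \<theta> i * \<omega> (I - {i})) =
          sign_at i I * (if i = k then 0 else rat_X k * \<theta> i) * chart_part k \<omega> (I - {i})"
        using *[OF i] by (simp only: if_False)
    qed
    finally show ?thesis .
  qed
qed

lemma chart_deriv_0 [simp]: "chart_deriv k i 0 = 0"
  by (simp add: chart_deriv_def)

text \<open>For \<open>i\<close> different from \<open>k\<close> the powers of \<open>x_k\<close>
  are constants for the derivative in \<open>x_i\<close>. The \<open>x_k\<close> contained in
  \<open>chart_deriv\<close> supplies the factor by which \<open>card I\<close> exceeds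
  \<open>card (I - {i})\<close>.\<close>

lemma chart_part_ext_deriv:
  "ext_deriv (chart_deriv k) (chart_part k \<omega>) = chart_part k (ext_deriv rat_pderiv \<omega>)"
proof
  fix I
  show "ext_deriv (chart_deriv k) (chart_part k \<omega>) I = chart_part k (ext_deriv rat_pderiv \<omega>) I"
  proof (cases "k \<in> I")
    case True
    then have "chart_deriv k i (chart_part k \<omega> (I - {i})) = 0" for i
      by (cases "i = k") (auto simp: chart_part_def chart_deriv_def)
    then show ?thesis
      using True by (simp add: ext_deriv_def) (simp add: chart_part_def)
  next
    case False
    have "sign_at i I * chart_deriv k i (chart_part k \<omega> (I - {i})) =
        rat_X k ^ card I * (sign_at i I * rat_pderiv i (\<omega> (I - {i})))" if "i \<in> I" for i
    proof -
      have card: "card I = Suc (card (I - {i}))"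
        using that by (intro card.remove) auto
      have ik: "i \<noteq> k"
        using that False by auto
      have "sign_at i I * chart_deriv k i (chart_part k \<omega> (I - {i})) =
          sign_at i I * (rat_X k * (rat_X k ^ card (I - {i}) * rat_pderiv i (\<omega> (I - {i}))))"
        using False ik by (simp add: chart_part_def chart_deriv_def rat_pderiv_mult rat_pderiv_X_power)
      then show ?thesis
        by (simp only: card power_Suc mult_ac)
    qed
    then have "ext_deriv (chart_deriv k) (chart_part k \<omega>) I =
        rat_X k ^ card I * ext_deriv rat_pderiv \<omega> I"
      by (simp only: ext_deriv_def sum_distrib_left cong: sum.cong)
    then show ?thesis
      using False by (simp add: chart_part_def)
  qed
qed

text \<open>This replaces all computation with transition functions: two forms with zero contraction
  are compared in one chart of choice.\<close>

lemma euler_zero_eqI: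
  assumes "euler_contraction \<omega> = 0" "euler_contraction \<eta> = 0" "chart_part k \<omega> = chart_part k \<eta>"
  shows "\<omega> = \<eta>"
proof
  fix I
  have eq: "\<omega> J = \<eta> J" if "k \<notin> J" for J
    using that fun_cong[OF assms(3), of J] by (simp add: chart_part_def)
  show "\<omega> I = \<eta> I"
  proof (cases "k \<in> I")
    case True
    have "rat_X k * \<omega> I = rat_X k * \<eta> I"
      unfolding euler_contraction_solve[OF True] using True
      by (auto simp: assms intro!: arg_cong[where f = "\<lambda>x. sign_at k I * x"] sum.cong eq)
    then show ?thesis
      by simp
  qed (rule eq)
qed

section \<open>Coframe monomials and changes of chart, computed through V\<close>

definition coframe_product ::
  "('n::{finite,linorder} \<Rightarrow> 'n crat \<Rightarrow> 'n crat) \<Rightarrow> 'n \<Rightarrow> 'n list \<Rightarrow> 'n form" where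
  "coframe_product D k xs = foldr (\<lambda>i. one_form_mult (\<lambda>l. D l (rat_X i / rat_X k))) xs (function_form 1)"

text \<open>Allowing arbitrary lists in place of sorted enumerations of sets makes induction over
  the factors possible.\<close>

lemma chart_monomial_eq:
  assumes "\<And>i. D i 0 = 0"
  shows "chart_monomial D k I = coframe_product D k (sorted_list_of_set I)"
  by (simp add: chart_monomial_def coframe_product_def differential_wedge[of D, OF assms])

lemma chart_part_function_form: "chart_part k (function_form g) = function_form g"
  by (auto simp: chart_part_def function_form_def fun_eq_iff)

text \<open>\<open>chart_deriv j\<close> is the rescaling that \<open>chart_part j\<close> performs
  on one-forms, so the monomials of chart \<open>k\<close> seen in chart \<open>j\<close> are the
  chart parts of their pullbacks to V.\<close>

lemma chart_part_coframe_product: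
  "chart_part j (coframe_product rat_pderiv k xs) = coframe_product (chart_deriv j) k xs"
  by (induction xs)
    (auto simp: coframe_product_def chart_part_function_form chart_part_one_form_mult chart_deriv_def)

lemma rat_pderiv_quotient_X:
  "rat_pderiv l (rat_X i / rat_X k) =
     (if l = i then 1 / rat_X k else 0) - (if l = k then rat_X i / (rat_X k)\<^sup>2 else 0)"
  by (simp add: divide_inverse[of "rat_X i"] rat_pderiv_mult rat_pderiv_inverse rat_pderiv_X)
    (simp add: field_simps)

lemma one_form_mult_zero [simp]: "one_form_mult \<theta> 0 = 0" "one_form_mult (\<lambda>_. 0) \<omega> = 0"
  by (simp_all add: one_form_mult_def fun_eq_iff)

text \<open>The quotient \<open>x_i/x_k\<close> has degree 0, so the Euler field annihilates it. The
  antiderivation rule passes this on to products.\<close>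

lemma euler_coframe_product: "euler_contraction (coframe_product rat_pderiv k xs) = 0"
proof (induction xs)
  case Nil
  show ?case
    by (simp add: coframe_product_def euler_contraction_def function_form_def fun_eq_iff)
next
  case (Cons i xs)
  have "(\<Sum>l\<in>UNIV. rat_X l * rat_pderiv l (rat_X i / rat_X k)) =
      (\<Sum>l\<in>UNIV. if l = i then rat_X i / rat_X k else 0) -
      (\<Sum>l\<in>UNIV. if l = k then rat_X i / rat_X k else 0)"
    unfolding sum_subtractf[symmetric]
    by (intro sum.cong refl) (simp add: rat_pderiv_quotient_X right_diff_distrib power2_eq_square)
  then have "(\<Sum>l\<in>UNIV. rat_X l * rat_pderiv l (rat_X i / rat_X k)) = 0"
    by simp
  moreover have "coframe_product rat_pderiv k (i # xs) =
      one_form_mult (\<lambda>l. rat_pderiv l (rat_X i / rat_X k)) (coframe_product rat_pderiv k xs)"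
    by (simp add: coframe_product_def)
  ultimately show ?case
    using Cons.IH by (intro ext) (simp add: euler_contraction_one_form_mult zero_fun_def[symmetric])
qed

text \<open>In its own chart the differential of \<open>x_i/x_k\<close> is the basis element
  \<open>e_i\<close>, or zero for \<open>i = k\<close>. As the list increases, each new factor
  precedes all others and no sign appears.\<close>

lemma coframe_product_chart:
  assumes "sorted_wrt (<) xs"
  shows "coframe_product (chart_deriv k) k xs = (\<lambda>J. if k \<notin> set xs \<and> J = set xs then 1 else 0)"
  using assms
proof (induction xs)
  case Nil
  then show ?case
    by (auto simp: coframe_product_def function_form_def)
next
  case (Cons i xs)
  have th: "(\<lambda>l. chart_deriv k l (rat_X i / rat_X k)) = (\<lambda>l. if i \<noteq> k \<and> l = i then 1 else 0)"
    by (auto simp: chart_deriv_def rat_pderiv_quotient_X fun_eq_iff)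
  let ?b = "\<lambda>J. if k \<notin> set xs \<and> J = set xs then 1 else (0 :: 'a crat)"
  have IH: "foldr (\<lambda>i. one_form_mult (\<lambda>l. chart_deriv k l (rat_X i / rat_X k))) xs (function_form 1) = ?b"
    using Cons by (simp add: coframe_product_def)
  have step: "coframe_product (chart_deriv k) k (i # xs) =
      one_form_mult (\<lambda>l. if i \<noteq> k \<and> l = i then 1 else 0) ?b"
    by (simp add: coframe_product_def th IH)
  show ?case
  proof
    fix J
    have nin: "i \<notin> set xs" and low: "{j \<in> set xs. j < i} = {}"
      using Cons.prems by auto
    have sg: "sign_at i (set xs) = 1"
      by (simp add: sign_at_def low)
    have *: "one_form_mult (\<lambda>l. if i \<noteq> k \<and> l = i then 1 else 0) ?b J =
        (if i \<noteq> k \<and> i \<in> J then sign_at i J * ?b (J - {i}) else 0)"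
    proof -
      have "one_form_mult (\<lambda>l. if i \<noteq> k \<and> l = i then 1 else 0) ?b J =
          (\<Sum>l\<in>J. if l = i then (if i \<noteq> k then sign_at i J * ?b (J - {i}) else 0) else 0)"
        unfolding one_form_mult_def by (intro sum.cong) auto
      then show ?thesis
        by simp
    qed
    show "coframe_product (chart_deriv k) k (i # xs) J =
        (if k \<notin> set (i # xs) \<and> J = set (i # xs) then 1 else 0)"
    proof (cases "J = insert i (set xs)")
      case True
      then show ?thesis
        unfolding step * using nin sg by (auto simp: insert_Diff_if)
    next
      case False
      then have "i \<in> J \<Longrightarrow> J - {i} \<noteq> set xs"
        by auto
      then show ?thesis
        unfolding step * using False by auto
    qed
  qed
qed

lemma change_coframe_apply:
  "change_coframe D k \<omega> J = (\<Sum>I\<in>UNIV. \<omega> I * chart_monomial D k I J)"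
  by (simp add: change_coframe_def sum_form_apply scale_form_def)

lemma change_coframe_add:
  "change_coframe D k (\<omega> + \<eta>) = change_coframe D k \<omega> + change_coframe D k \<eta>"
  by (simp add: fun_eq_iff change_coframe_apply distrib_right sum.distrib)

lemma change_coframe_scale:
  "change_coframe D k (scale_form c \<omega>) = scale_form c (change_coframe D k \<omega>)"
  by (simp add: fun_eq_iff change_coframe_apply scale_form_def sum_distrib_left mult.assoc)

lemma chart_part_change_coframe:
  "chart_part j (change_coframe rat_pderiv k \<omega>) = change_coframe (chart_deriv j) k \<omega>"
proof
  fix J
  have "chart_monomial (chart_deriv j) k I J = chart_part j (chart_monomial rat_pderiv k I) J" for I
    by (simp add: chart_monomial_eq chart_part_coframe_product)
  then show "chart_part j (change_coframe rat_pderiv k \<omega>) J = change_coframe (chart_deriv j) k \<omega> J"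
    by (simp add: change_coframe_apply chart_part_def sum_distrib_left mult_ac)
qed

lemma euler_change_coframe: "euler_contraction (change_coframe rat_pderiv k \<omega>) = 0"
proof
  fix J
  have e: "euler_contraction (chart_monomial rat_pderiv k I) J = 0" for I
    by (simp add: chart_monomial_eq euler_coframe_product)
  have "euler_contraction (change_coframe rat_pderiv k \<omega>) J =
      (\<Sum>i\<in>-J. \<Sum>I\<in>UNIV. \<omega> I * (sign_at i J * rat_X i * chart_monomial rat_pderiv k I (insert i J)))"
    unfolding euler_contraction_def change_coframe_apply by (simp only: sum_distrib_left mult_ac)
  also have "\<dots> = (\<Sum>I\<in>UNIV. \<omega> I * euler_contraction (chart_monomial rat_pderiv k I) J)"
    unfolding euler_contraction_def sum_distrib_left by (rule sum.swap)
  finally show "euler_contraction (change_coframe rat_pderiv k \<omega>) J = 0 J"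
    by (simp add: e)
qed

lemma change_coframe_same_chart:
  "change_coframe (chart_deriv k) k \<omega> J = (if k \<in> J then 0 else \<omega> J)"
proof -
  have "change_coframe (chart_deriv k) k \<omega> J = (\<Sum>I\<in>UNIV. if I = J then if k \<in> J then 0 else \<omega> J else 0)"
    unfolding change_coframe_apply
    by (intro sum.cong refl)
      (auto simp: chart_monomial_eq coframe_product_chart)
  then show ?thesis
    by simp
qed

section \<open>Rational forms on projective space as forms on \<open>V\<close>\<close>

text \<open>With \<open>dx_i\<close> in degree 1, coefficients of degree \<open>- card I\<close>
  mean total degree 0.\<close>

definition basic_forms :: "nat \<Rightarrow> 'n::{finite,linorder} form set" where
  "basic_forms p = {\<eta>. euler_contraction \<eta> = 0 \<and>
     (\<forall>I. homogeneous_rat (- int (card I)) (\<eta> I) \<and> (card I \<noteq> p \<longrightarrow> \<eta> I = 0))}"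

definition chart_forms :: "'n::{finite,linorder} form \<Rightarrow> 'n pform" where
  "chart_forms \<eta> = (\<lambda>k. chart_part k \<eta>)"

lemma pullback_form_eqI:
  assumes "\<And>k. \<eta> = change_coframe rat_pderiv k (\<omega> k)"
  shows "pullback_form \<omega> = \<eta>"
  unfolding pullback_form_def by (rule the_equality) (use assms in auto)

lemma rational_pformsD:
  assumes "\<omega> \<in> rational_pforms p"
  shows "homogeneous_rat 0 (\<omega> k I)" "k \<in> I \<or> card I \<noteq> p \<Longrightarrow> \<omega> k I = 0"
    "\<omega> j = change_coframe (chart_deriv j) k (\<omega> k)"
  using assms unfolding rational_pforms_def by blast+

text \<open>Shows that the description in \<open>pullback_form\<close> is met. The pullbacks from
  charts \<open>k\<close> and \<open>j\<close> both have zero contraction, and both have chart part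
  \<open>\<omega> j\<close> in chart \<open>j\<close>.\<close>

lemma pullback_form_rational:
  assumes "\<omega> \<in> rational_pforms p"
  shows "pullback_form \<omega> = change_coframe rat_pderiv k (\<omega> k)"
proof (rule pullback_form_eqI)
  fix j
  show "change_coframe rat_pderiv k (\<omega> k) = change_coframe rat_pderiv j (\<omega> j)"
  proof (rule euler_zero_eqI[where k = j])
    show "chart_part j (change_coframe rat_pderiv k (\<omega> k)) = chart_part j (change_coframe rat_pderiv j (\<omega> j))"
      unfolding chart_part_change_coframe using rational_pformsD(3)[OF assms] by metis
  qed (rule euler_change_coframe)+
qed

lemma chart_part_pullback_form:
  assumes "\<omega> \<in> rational_pforms p"
  shows "chart_part k (pullback_form \<omega>) = \<omega> k"
  using rational_pformsD(3)[OF assms]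
  by (metis pullback_form_rational[OF assms] chart_part_change_coframe)

lemma chart_forms_pullback_form:
  "\<omega> \<in> rational_pforms p \<Longrightarrow> chart_forms (pullback_form \<omega>) = \<omega>"
  by (simp add: chart_forms_def chart_part_pullback_form)

lemma euler_pullback_form:
  assumes "\<omega> \<in> rational_pforms p"
  shows "euler_contraction (pullback_form \<omega>) = 0"
  unfolding pullback_form_rational[OF assms, of undefined] by (rule euler_change_coframe)

lemma card_exchange: "finite I \<Longrightarrow> k \<in> I \<Longrightarrow> i \<notin> I \<Longrightarrow> card (insert i (I - {k})) = card I"
  by (simp add: card.remove[of I k] del: card_Diff_insert card_Diff_singleton)

lemma pullback_form_basic:
  assumes "\<omega> \<in> rational_pforms p"
  shows "pullback_form \<omega> \<in> basic_forms p"
proof -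
  define k :: 'a where "k = undefined"
  let ?\<eta> = "pullback_form \<omega>"
  have off: "?\<eta> I = inverse (rat_X k ^ card I) * \<omega> k I" if "k \<notin> I" for I
    using that fun_cong[OF chart_part_pullback_form[OF assms, of k], of I]
    by (simp add: chart_part_def field_simps)
  have on: "?\<eta> I = inverse (rat_X k) * (sign_at k I *
      - (\<Sum>i\<in>-I. sign_at i (I - {k}) * (rat_X i * ?\<eta> (insert i (I - {k})))))" if "k \<in> I" for I
    using euler_contraction_solve[OF that, of ?\<eta>]
    by (simp add: euler_pullback_form[OF assms] field_simps)
  have hom_off: "homogeneous_rat (- int (card I)) (?\<eta> I)" if "k \<notin> I" for I
  proof -
    have "homogeneous_rat (- int (card I) + 0) (?\<eta> I)"
      unfolding off[OF that]
      by (intro homogeneous_rat_mult homogeneous_rat_inverse homogeneous_rat_X_power rational_pformsD[OF assms])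
    then show ?thesis by simp
  qed
  have card: "card (insert i (I - {k})) = card I" if "k \<in> I" "i \<in> - I" for i I
    using that by (intro card_exchange) auto
  have hom: "homogeneous_rat (- int (card I)) (?\<eta> I)" for I
  proof (cases "k \<in> I")
    case True
    \<comment> \<open>The summands are the degrees of \<open>1/x_k\<close>, the two signs,
      \<open>x_i\<close> and the coefficient of the pullback.\<close>
    have "homogeneous_rat (- 1 + (0 + (0 + (1 + - int (card I))))) (?\<eta> I)"
      unfolding on[OF True]
    proof (intro homogeneous_rat_mult homogeneous_rat_inverse homogeneous_rat_uminus homogeneous_rat_sum
        homogeneous_rat_X homogeneous_rat_sign_at)
      fix i assume i: "i \<in> - I"
      then have "k \<notin> insert i (I - {k})"
        using True by auto
      from hom_off[OF this] show "homogeneous_rat (- int (card I)) (?\<eta> (insert i (I - {k})))"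
        using card[OF True i] by simp
    qed
    then show ?thesis by simp
  qed (rule hom_off)
  have zero_off: "?\<eta> I = 0" if "k \<notin> I" "card I \<noteq> p" for I
    using off[OF that(1)] rational_pformsD(2)[OF assms, of k I] that by simp
  have zero: "?\<eta> I = 0" if "card I \<noteq> p" for I
  proof (cases "k \<in> I")
    case True
    have "?\<eta> (insert i (I - {k})) = 0" if "i \<in> - I" for i
      using card[OF True that] True that \<open>card I \<noteq> p\<close> by (intro zero_off) auto
    then have "(\<Sum>i\<in>-I. sign_at i (I - {k}) * (rat_X i * ?\<eta> (insert i (I - {k})))) = 0"
      by (intro sum.neutral) auto
    then show ?thesis
      using on[OF True] by simp
  qed (use zero_off that in auto)
  show ?thesis
    using hom zero euler_pullback_form[OF assms] by (simp add: basic_forms_def)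
qed

lemma change_coframe_chart_part:
  assumes "euler_contraction \<eta> = 0"
  shows "change_coframe rat_pderiv k (chart_part k \<eta>) = \<eta>"
proof (rule euler_zero_eqI[where k = k])
  show "chart_part k (change_coframe rat_pderiv k (chart_part k \<eta>)) = chart_part k \<eta>"
    unfolding chart_part_change_coframe
    by (rule ext) (simp add: change_coframe_same_chart chart_part_def)
qed (use assms euler_change_coframe in auto)

text \<open>Compatibility holds because all charts are read off the same form on V, which is rebuilt
  from its chart part in \<open>k\<close>.\<close>

lemma chart_forms_rational:
  assumes "\<eta> \<in> basic_forms p"
  shows "chart_forms \<eta> \<in> rational_pforms p"
proof -
  have \<eta>: "euler_contraction \<eta> = 0" "\<And>I. homogeneous_rat (- int (card I)) (\<eta> I)"
    "\<And>I. card I \<noteq> p \<Longrightarrow> \<eta> I = 0"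
    using assms by (auto simp: basic_forms_def)
  have "homogeneous_rat 0 (rat_X k ^ card I * \<eta> I)" for k I
    using homogeneous_rat_mult[OF homogeneous_rat_X_power[of "card I" k] \<eta>(2)[of I]] by simp
  then have 1: "homogeneous_rat 0 (chart_forms \<eta> k I)"
      "k \<in> I \<or> card I \<noteq> p \<Longrightarrow> chart_forms \<eta> k I = 0" for k I
    using \<eta>(3) by (auto simp: chart_forms_def chart_part_def)
  have 2: "chart_forms \<eta> j = change_coframe (chart_deriv j) k (chart_forms \<eta> k)" for j k
    using change_coframe_chart_part[OF \<eta>(1), of k] chart_part_change_coframe[of j k "chart_part k \<eta>"]
    by (simp add: chart_forms_def)
  show ?thesis
    unfolding rational_pforms_def using 1 2 by blast
qed

lemma pullback_form_chart_forms:
  assumes "euler_contraction \<eta> = 0"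
  shows "pullback_form (chart_forms \<eta>) = \<eta>"
  by (rule pullback_form_eqI) (simp add: chart_forms_def change_coframe_chart_part[OF assms])

lemma pform_deriv_chart_forms: "pform_deriv (chart_forms \<eta>) = chart_forms (ext_deriv rat_pderiv \<eta>)"
  by (simp add: pform_deriv_def chart_forms_def chart_part_ext_deriv)

lemma pullback_form_add:
  assumes "\<omega> \<in> rational_pforms p" "\<eta> \<in> rational_pforms p"
  shows "pullback_form (\<omega> + \<eta>) = pullback_form \<omega> + pullback_form \<eta>"
  by (rule pullback_form_eqI)
    (simp add: change_coframe_add flip: pullback_form_rational[OF assms(1)] pullback_form_rational[OF assms(2)])

lemma pullback_form_scale:
  assumes "\<omega> \<in> rational_pforms p"
  shows "pullback_form (scale_pform c \<omega>) = scale_form c (pullback_form \<omega>)"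
  by (rule pullback_form_eqI)
    (simp add: scale_pform_def change_coframe_scale flip: pullback_form_rational[OF assms])

section \<open>Points and local denominators\<close>

text \<open>Rescaling a vector multiplies the value of a homogeneous polynomial by a power of the
  scalar, so a spanning vector of the line decides vanishing.\<close>

lemma proj_space_generator:
  assumes "q \<in> proj_space"
  obtains v where "v \<noteq> 0" "\<And>a d. homogeneous_poly d a \<Longrightarrow> vanishes_at a q \<longleftrightarrow> poly_eval a v = 0"
proof -
  have q: "vec.subspace q" "vec.dim q = 1"
    using assms by (auto simp: proj_space_def)
  obtain B where B: "B \<subseteq> q" "vec.independent B" "q \<subseteq> vec.span B" "card B = vec.dim q"
    using vec.basis_exists by blast
  obtain v where v: "B = {v}"
    using B(4) q(2) by (auto simp: card_1_singleton_iff)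
  have v0: "v \<noteq> 0"
    using B(2) v vec.dependent_zero by blast
  have "vanishes_at a q \<longleftrightarrow> poly_eval a v = 0" if "homogeneous_poly d a" for a d
  proof
    assume "vanishes_at a q"
    then show "poly_eval a v = 0"
      using v v0 B(1) by (auto simp: vanishes_at_def)
  next
    assume "poly_eval a v = 0"
    then show "vanishes_at a q"
      using B(3) v poly_eval_scale[OF that]
      by (auto simp: vanishes_at_def vec.span_singleton)
  qed
  then show ?thesis
    using that v0 by blast
qed

text \<open>The degree is an explicit argument because it becomes the degree of the numerator in a
  section of the associated sheaf.\<close>

definition denominator_at :: "'n::finite ppoint \<Rightarrow> nat \<Rightarrow> 'n cpoly \<Rightarrow> bool" where
  "denominator_at q d b \<longleftrightarrow> homogeneous_poly d b \<and> \<not> vanishes_at b q"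

lemma vanishes_at_mult:
  assumes "q \<in> proj_space" "homogeneous_poly d a" "homogeneous_poly e b"
  shows "vanishes_at (a * b) q \<longleftrightarrow> vanishes_at a q \<or> vanishes_at b q"
  by (rule proj_space_generator[OF assms(1)])
    (use homogeneous_poly_mult[OF assms(2,3)] assms in \<open>simp add: poly_eval_mult\<close>)

lemma denominator_at_mult:
  "q \<in> proj_space \<Longrightarrow> denominator_at q d a \<Longrightarrow> denominator_at q e b \<Longrightarrow> denominator_at q (d + e) (a * b)"
  by (auto simp: denominator_at_def vanishes_at_mult homogeneous_poly_mult)

lemma denominator_at_1:
  assumes "q \<in> proj_space"
  shows "denominator_at q 0 1"
  by (rule proj_space_generator[OF assms])
    (metis denominator_at_def homogeneous_poly_1 poly_eval_1 zero_neq_one)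

lemma denominator_at_power:
  "q \<in> proj_space \<Longrightarrow> denominator_at q d a \<Longrightarrow> denominator_at q (k * d) (a ^ k)"
  by (induction k) (auto simp: denominator_at_1 denominator_at_mult)

lemma denominator_at_nonzero: "denominator_at q d b \<Longrightarrow> b \<noteq> 0"
  by (auto simp: denominator_at_def vanishes_at_def poly_eval_0)

lemma denominator_at_X:
  assumes "q \<in> proj_space"
  obtains k where "denominator_at q 1 (poly_X k)"
proof -
  obtain v where v: "v \<noteq> 0" "\<And>a d. homogeneous_poly d a \<Longrightarrow> vanishes_at a q \<longleftrightarrow> poly_eval a v = 0"
    using proj_space_generator[OF assms] by metis
  obtain k where "v $ k \<noteq> 0"
    using v(1) by (auto simp: vec_eq_iff)
  then have "denominator_at q 1 (poly_X k)"
    using v(2)[OF homogeneous_poly_X] homogeneous_poly_X by (metis denominator_at_def poly_eval_X)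
  then show ?thesis
    using that by blast
qed

text \<open>The coefficients of \<eta> and of its differential each come with a denominator of their
  own. The product of finitely many still does not vanish at \<open>q\<close>.\<close>

lemma common_denominator:
  assumes q: "q \<in> proj_space" and "finite S"
    and "\<And>x. x \<in> S \<Longrightarrow> \<exists>d b. denominator_at q d b \<and> rat_of_poly b * g x \<in> range rat_of_poly"
  shows "\<exists>d b. denominator_at q d b \<and> (\<forall>x\<in>S. rat_of_poly b * g x \<in> range rat_of_poly)"
  using assms(2,3)
proof (induction S rule: finite_induct)
  case empty
  then show ?case
    using denominator_at_1[OF q] by blast
next
  case (insert x S)
  obtain d b where b: "denominator_at q d b" "\<forall>x\<in>S. rat_of_poly b * g x \<in> range rat_of_poly"
    using insert.IH insert.prems by auto
  obtain e c where c: "denominator_at q e c" "rat_of_poly c * g x \<in> range rat_of_poly"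
    using insert.prems[of x] by blast
  have "rat_of_poly (b * c) * g y \<in> range rat_of_poly" if "y \<in> insert x S" for y
  proof (cases "y = x")
    case True
    have "rat_of_poly (b * c) * g y = rat_of_poly b * (rat_of_poly c * g x)"
      unfolding rat_of_poly_mult True by (simp only: mult_ac)
    then show ?thesis
      by (simp only: poly_range_mult[OF rangeI c(2)])
  next
    case False
    then have "rat_of_poly b * g y \<in> range rat_of_poly"
      using b that by auto
    moreover have "rat_of_poly (b * c) * g y = rat_of_poly c * (rat_of_poly b * g y)"
      unfolding rat_of_poly_mult by (simp only: mult_ac)
    ultimately show ?thesis
      by (simp only: poly_range_mult[OF rangeI])
  qed
  then show ?case
    using denominator_at_mult[OF q b(1) c(1)] by blast
qed

lemma local_ring_denominator:
  assumes "g \<in> local_ring q"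
  obtains d b where "denominator_at q d b" "rat_of_poly b * g \<in> range rat_of_poly"
proof -
  obtain a b d where g: "g = Fract a b" "homogeneous_poly d b" "\<not> vanishes_at b q"
    using assms by (auto simp: local_ring_def)
  have b: "denominator_at q d b"
    using g by (simp add: denominator_at_def)
  then have "rat_of_poly b * g = rat_of_poly a"
    using denominator_at_nonzero[OF b] g(1) by (simp add: eq_fract mult.commute)
  then show ?thesis
    using that b by blast
qed

text \<open>\<open>local_ring\<close> demands a homogeneous numerator of the degree of the
  denominator. For \<open>g\<close> of degree 0 the polynomial \<open>b * g\<close> is automatically
  such a numerator.\<close>

lemma local_ringI:
  assumes hom: "homogeneous_rat 0 g" and b: "denominator_at q d b"
    and bg: "rat_of_poly b * g \<in> range rat_of_poly"
  shows "g \<in> local_ring q"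
proof -
  have b0: "b \<noteq> 0" "homogeneous_poly d b" "\<not> vanishes_at b q"
    using b denominator_at_nonzero[OF b] by (auto simp: denominator_at_def)
  have "homogeneous_rat (int d) (rat_of_poly b * g)"
    using homogeneous_rat_mult[OF homogeneous_rat_poly[OF b0(2)] hom] by simp
  then obtain u where u: "rat_of_poly b * g = rat_of_poly u" "homogeneous_poly d u"
  proof (cases "rat_of_poly b * g = 0")
    case True
    then show ?thesis
      using that[of 0] by (simp add: rat_of_poly_0)
  next
    case False
    with bg \<open>homogeneous_rat (int d) (rat_of_poly b * g)\<close> show ?thesis
      by (elim poly_range_homogeneous) (use that in auto)
  qed
  have "g = rat_of_poly u / rat_of_poly b"
    using u(1) b0(1) by (simp add: rat_of_poly_eq_0_iff nonzero_eq_divide_eq mult.commute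
        del: divide_fract mult_fract)
  then have "g = Fract u b"
    by simp
  then show ?thesis
    using u(2) b0 by (auto simp: local_ring_def)
qed

section \<open>Logarithmic forms\<close>

lemma wedge_scale: "scale_form c \<omega> \<and>\<^sub>f \<eta> = scale_form c (\<omega> \<and>\<^sub>f \<eta>)"
  by (simp add: wedge_def scale_form_def sum_distrib_left mult_ac)

lemma poly_forms_over_iff:
  assumes "f \<noteq> 0"
  shows "\<omega> \<in> poly_forms_over f p \<longleftrightarrow>
    (\<forall>I. rat_of_poly f * \<omega> I \<in> range rat_of_poly \<and> (card I \<noteq> p \<longrightarrow> \<omega> I = 0))"
proof
  have f: "rat_of_poly f \<noteq> 0"
    using assms by (simp add: rat_of_poly_eq_0_iff)
  have fi: "rat_of_poly f * (inverse (rat_of_poly f) * x) = x"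
      "inverse (rat_of_poly f) * (rat_of_poly f * x) = x" for x
    unfolding mult.assoc[symmetric] by (simp_all only: right_inverse[OF f] left_inverse[OF f] mult_1)
  show "\<forall>I. rat_of_poly f * \<omega> I \<in> range rat_of_poly \<and> (card I \<noteq> p \<longrightarrow> \<omega> I = 0)"
    if om: "\<omega> \<in> poly_forms_over f p"
  proof -
    obtain \<eta> where \<eta>: "\<eta> \<in> poly_forms p" "\<omega> = scale_form (inverse (rat_of_poly f)) \<eta>"
      using om unfolding poly_forms_over_def by blast
    have "rat_of_poly f * \<omega> I = \<eta> I" for I
      unfolding \<eta>(2) scale_form_def by (rule fi)
    moreover have "\<eta> I \<in> range rat_of_poly" "card I \<noteq> p \<Longrightarrow> \<omega> I = 0" for I
      using \<eta> by (auto simp: poly_forms_def scale_form_def simp del: inverse_fract)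
    ultimately show ?thesis by metis
  qed
  show "\<omega> \<in> poly_forms_over f p"
    if "\<forall>I. rat_of_poly f * \<omega> I \<in> range rat_of_poly \<and> (card I \<noteq> p \<longrightarrow> \<omega> I = 0)"
    unfolding poly_forms_over_def
  proof (rule image_eqI)
    show "\<omega> = scale_form (inverse (rat_of_poly f)) (\<lambda>I. rat_of_poly f * \<omega> I)"
      by (simp only: scale_form_def fi)
    show "(\<lambda>I. rat_of_poly f * \<omega> I) \<in> poly_forms p"
      using that by (simp add: poly_forms_def)
  qed
qed

text \<open>Regularity at index sets without \<open>k\<close> extends to all index sets at the price
  of one factor \<open>x_k\<close>, provided that the contraction is regular after multiplication by
  \<open>g\<close>.\<close>

lemma euler_solve_range:
  assumes "k \<in> I" and "g * euler_contraction \<omega> (I - {k}) \<in> range rat_of_poly"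
    and off: "\<And>J. k \<notin> J \<Longrightarrow> g * \<omega> J \<in> range rat_of_poly"
  shows "rat_X k * (g * \<omega> I) \<in> range rat_of_poly"
proof -
  have "rat_X k * (g * \<omega> I) = g * (rat_X k * \<omega> I)"
    by (simp only: mult_ac)
  also have "\<dots> = sign_at k I * (g * euler_contraction \<omega> (I - {k}) -
      (\<Sum>i\<in>-I. sign_at i (I - {k}) * rat_X i * (g * \<omega> (insert i (I - {k})))))"
    unfolding euler_contraction_solve[OF assms(1)]
    by (simp only: right_diff_distrib sum_distrib_left mult_ac)
  also have "\<dots> \<in> range rat_of_poly"
    by (intro poly_range_mult[OF poly_range_sign_at] poly_range_diff assms(2) poly_range_sum
        poly_range_mult[OF poly_range_mult[OF poly_range_sign_at poly_range_rat_X]] off)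
      (use assms(1) in auto)
  finally show ?thesis .
qed

section \<open>The defining forms of the arrangement and its logarithmic forms\<close>

locale central_arrangement =
  fixes A :: "'n::{finite,linorder} cspace set set" and \<alpha> :: "'n cspace set \<Rightarrow> 'n cpoly"
  assumes finite_A: "finite A"
    and hyperplanes: "H \<in> A \<Longrightarrow> linear_hyperplane H"
    and forms: "defining_forms A \<alpha>"
begin

abbreviation f :: "'n crat" where "f \<equiv> rat_of_poly (defining_poly A \<alpha>)"

abbreviation a :: "'n cspace set \<Rightarrow> 'n crat" where "a H \<equiv> rat_of_poly (\<alpha> H)"

abbreviation dform_mult :: "'n crat \<Rightarrow> 'n form \<Rightarrow> 'n form" where
  "dform_mult g \<equiv> one_form_mult (\<lambda>i. rat_pderiv i g)"

lemma alpha_homogeneous: "H \<in> A \<Longrightarrow> homogeneous_poly 1 (\<alpha> H)"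
  and alpha_kernel: "H \<in> A \<Longrightarrow> H = {v. poly_eval (\<alpha> H) v = 0}"
  using forms by (auto simp: defining_forms_def)

lemma alpha_nonzero: assumes "H \<in> A" shows "\<alpha> H \<noteq> 0"
proof
  assume "\<alpha> H = 0"
  then have "H = UNIV"
    using alpha_kernel[OF assms] by (simp add: poly_eval_0)
  then have "vec.dim H = CARD('n)"
    by (simp only: vec_dim_card)
  then show False
    using hyperplanes[OF assms] by (simp add: linear_hyperplane_def)
qed

text \<open>Divisibility would give an inclusion of kernels, and these are subspaces of equal
  dimension.\<close>

lemma alpha_not_dvd:
  assumes "H \<in> A" "H' \<in> A" "H \<noteq> H'"
  shows "\<not> \<alpha> H dvd \<alpha> H'"
proof
  assume "\<alpha> H dvd \<alpha> H'"
  then have sub: "H \<subseteq> H'"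
    using alpha_kernel[OF assms(1)] alpha_kernel[OF assms(2)] poly_eval_mult
    by (metis (mono_tags, lifting) dvd_def mem_Collect_eq mult_zero_left subsetI)
  have "vec.subspace H" "vec.subspace H'" "vec.dim H' \<le> vec.dim H"
    using hyperplanes[OF assms(1)] hyperplanes[OF assms(2)] by (auto simp: linear_hyperplane_def)
  then show False
    using vec.subspace_dim_equal[of H H'] sub assms(3) by blast
qed

lemma defining_poly_nonzero: "defining_poly A \<alpha> \<noteq> 0"
  using finite_A alpha_nonzero by (auto simp: defining_poly_def)

lemma f_nonzero [simp]: "f \<noteq> 0" and a_nonzero [simp]: "H \<in> A \<Longrightarrow> a H \<noteq> 0"
  using defining_poly_nonzero alpha_nonzero by (auto simp: rat_of_poly_eq_0_iff)

lemma defining_poly_homogeneous: "homogeneous_poly (card A) (defining_poly A \<alpha>)"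
  using homogeneous_poly_prod[of A "\<lambda>_. 1" \<alpha>] alpha_homogeneous by (simp add: defining_poly_def)

text \<open>Denominators are cleared. The degree condition on d\<alpha> wedge \<omega> follows from
  that on \<omega>, since each term removes exactly one index.\<close>

lemma log_forms_iff:
  "\<omega> \<in> log_forms A \<alpha> p \<longleftrightarrow>
     (\<forall>I. f * \<omega> I \<in> range rat_of_poly \<and> (card I \<noteq> p \<longrightarrow> \<omega> I = 0)) \<and>
     (\<forall>H\<in>A. \<forall>I. f * (inverse (a H) * dform_mult (a H) \<omega> I) \<in> range rat_of_poly)"
proof -
  have deg: "dform_mult g \<omega> I = 0" if "\<And>J. card J \<noteq> p \<Longrightarrow> \<omega> J = 0" "card I \<noteq> p + 1" for g I
    unfolding one_form_mult_def
  proof (rule sum.neutral, safe)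
    fix i assume "i \<in> I"
    then have "card I = Suc (card (I - {i}))"
      by (intro card.remove) auto
    then have "card (I - {i}) \<noteq> p"
      using that(2) by linarith
    then show "sign_at i I * rat_pderiv i g * \<omega> (I - {i}) = 0"
      using that(1) by simp
  qed
  show ?thesis
    unfolding log_forms_def mem_Collect_eq poly_forms_over_iff[OF defining_poly_nonzero]
      wedge_scale differential_wedge[of rat_pderiv, OF rat_pderiv_0]
    using deg by (auto simp: scale_form_def simp del: inverse_fract mult_fract)
qed

lemma df_expansion: "rat_pderiv i f = f * (\<Sum>H\<in>A. rat_pderiv i (a H) / a H)"
  unfolding defining_poly_def rat_of_poly_prod
  by (rule rat_pderiv_prod) (use finite_A a_nonzero in auto)

text \<open>By the logarithmic derivative of the product, \<open>df\<close> wedge \<omega> is a sum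
  of terms \<open>f\<close> (d\<alpha>/\<alpha>) wedge \<omega>, one for each hyperplane, all
  polynomial by the definition of logarithmic forms.\<close>

lemma df_mult_log_form:
  assumes "\<omega> \<in> log_forms A \<alpha> p"
  shows "dform_mult f \<omega> I \<in> range rat_of_poly"
proof -
  have "sign_at i I * rat_pderiv i f * \<omega> (I - {i}) =
      (\<Sum>H\<in>A. f * (inverse (a H) * (sign_at i I * rat_pderiv i (a H) * \<omega> (I - {i}))))" for i
    unfolding df_expansion divide_inverse
    by (simp only: sum_distrib_left sum_distrib_right mult_ac)
  then have "dform_mult f \<omega> I =
      (\<Sum>i\<in>I. \<Sum>H\<in>A. f * (inverse (a H) * (sign_at i I * rat_pderiv i (a H) * \<omega> (I - {i}))))"
    unfolding one_form_mult_def by (simp only:)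
  also have "\<dots> = (\<Sum>H\<in>A. f * (inverse (a H) * dform_mult (a H) \<omega> I))"
    unfolding one_form_mult_def sum_distrib_left by (rule sum.swap)
  also have "\<dots> \<in> range rat_of_poly"
    by (intro poly_range_sum) (use assms in \<open>simp only: log_forms_iff\<close>)
  finally show ?thesis .
qed

lemma simple_pole_iff:
  assumes "q \<in> proj_space"
  shows "simple_pole_at A \<alpha> (chart_forms \<eta>) q \<longleftrightarrow> (\<forall>k. denominator_at q 1 (poly_X k) \<longrightarrow>
    (\<forall>I. k \<notin> I \<longrightarrow> f / rat_X k ^ card A * (rat_X k ^ card I * \<eta> I) \<in> local_ring q))"
proof -
  have "Fract (defining_poly A \<alpha>) (poly_X k ^ card A) = f / rat_X k ^ card A" for k
    by (simp only: Fract_eq_divide[of _ "poly_X k ^ card A"] rat_of_poly_power rat_X_def)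
  moreover have "0 \<in> local_ring q"
    by (rule local_ringI[OF _ denominator_at_1[OF assms]]) auto
  ultimately show ?thesis
    unfolding simple_pole_at_def chart_forms_def chart_part_def denominator_at_def
    using homogeneous_poly_X by auto
qed

text \<open>The local equation differs from \<open>f\<close> by a power of \<open>x_k\<close>, which
  is nonzero at \<open>q\<close>. Multiplying by \<open>x_k ^ card A\<close> therefore reduces the
  claim to the regularity of \<open>f * \<eta> I\<close>.\<close>

lemma simple_poleI:
  assumes q: "q \<in> proj_space" and b: "denominator_at q d b"
    and hom: "\<And>I. homogeneous_rat (- int (card I)) (\<eta> I)"
    and bf: "\<And>I. rat_of_poly b * (f * \<eta> I) \<in> range rat_of_poly"
  shows "simple_pole_at A \<alpha> (chart_forms \<eta>) q"
  unfolding simple_pole_iff[OF q]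
proof (intro allI impI)
  fix k I assume k: "denominator_at q 1 (poly_X k)"
  let ?g = "f / rat_X k ^ card A * (rat_X k ^ card I * \<eta> I)"
  have "homogeneous_rat (int (card A) + - int (card A) + (int (card I) + - int (card I))) ?g"
    unfolding divide_inverse
    by (intro homogeneous_rat_mult homogeneous_rat_inverse homogeneous_rat_X_power hom
        homogeneous_rat_poly defining_poly_homogeneous)
  then have "homogeneous_rat 0 ?g"
    by simp
  moreover have "rat_of_poly (poly_X k ^ card A * b) * ?g \<in> range rat_of_poly"
  proof -
    have "rat_of_poly (poly_X k ^ card A * b) * ?g = rat_X k ^ card I * (rat_of_poly b * (f * \<eta> I))"
      by (simp add: rat_of_poly_mult rat_of_poly_power rat_X_def[symmetric] del: mult_fract)
    then show ?thesis
      by (simp only: poly_range_intros bf)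
  qed
  ultimately show "?g \<in> local_ring q"
    by (rule local_ringI[OF _ denominator_at_mult[OF q denominator_at_power[OF q k] b]])
qed

lemma ext_deriv_homogeneous:
  assumes "\<And>I. homogeneous_rat (- int (card I)) (\<eta> I)"
  shows "homogeneous_rat (- int (card I)) (ext_deriv rat_pderiv \<eta> I)"
  unfolding ext_deriv_def
proof (rule homogeneous_rat_sum)
  fix i assume "i \<in> I"
  then have "card I = Suc (card (I - {i}))"
    by (intro card.remove) auto
  then have deg: "- int (card I) = 0 + (- int (card (I - {i})) - 1)"
    by linarith
  show "homogeneous_rat (- int (card I)) (sign_at i I * rat_pderiv i (\<eta> (I - {i})))"
    unfolding deg by (intro homogeneous_rat_mult homogeneous_rat_sign_at homogeneous_rat_pderiv assms)
qed

section \<open>From fractions of logarithmic forms to forms with simple poles\<close>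

lemma fraction_basic:
  assumes m: "m \<in> log_forms0_deg A \<alpha> p (int d)" and b: "homogeneous_poly d b"
  shows "scale_form (inverse (rat_of_poly b)) m \<in> basic_forms p"
proof -
  have m': "\<And>I. card I \<noteq> p \<Longrightarrow> m I = 0" "euler_contraction m = 0"
      "\<And>I. homogeneous_rat (int d - int (card I)) (m I)"
    using m by (auto simp: log_forms0_deg_def log_forms0_def log_forms_iff)
  let ?\<eta> = "scale_form (inverse (rat_of_poly b)) m"
  have "homogeneous_rat (- int d + (int d - int (card I))) (?\<eta> I)" for I
    unfolding scale_form_def
    by (intro homogeneous_rat_mult homogeneous_rat_inverse homogeneous_rat_poly b m')
  moreover have "euler_contraction ?\<eta> = scale_form (inverse (rat_of_poly b)) (euler_contraction m)"
    by (simp only: euler_contraction_def scale_form_def sum_distrib_left mult_ac)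
  ultimately show ?thesis
    using m' by (simp add: basic_forms_def scale_form_def fun_eq_iff del: inverse_fract)
qed

text \<open>
  \<open>f dm = d(fm) - df \<and> m\<close>, where \<open>df/f\<close> is the sum of the \<open>d\<alpha>\<^sub>H/\<alpha>\<^sub>H\<close>, so a logarithmic form \<open>m\<close>
  has \<open>dm\<close> with at most simple poles.
\<close>

lemma fraction_simple_poles:
  assumes q: "q \<in> proj_space" and m: "m \<in> log_forms0_deg A \<alpha> p (int d)" and b: "denominator_at q d b"
  defines "\<eta> \<equiv> scale_form (inverse (rat_of_poly b)) m"
  shows "simple_pole_at A \<alpha> (chart_forms \<eta>) q" "simple_pole_at A \<alpha> (pform_deriv (chart_forms \<eta>)) q"
proof -
  let ?b = "rat_of_poly b"
  have b0: "?b \<noteq> 0"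
    using denominator_at_nonzero[OF b] by (simp add: rat_of_poly_eq_0_iff)
  have hom: "homogeneous_rat (- int (card I)) (\<eta> I)" for I
    using fraction_basic[OF m] b by (auto simp: \<eta>_def basic_forms_def denominator_at_def)
  have log: "m \<in> log_forms A \<alpha> p"
    using m by (auto simp: log_forms0_deg_def log_forms0_def)
  then have fm: "f * m I \<in> range rat_of_poly" for I
    by (simp add: log_forms_iff)
  have m: "m I = ?b * \<eta> I" for I
    using b0 by (simp add: \<eta>_def scale_form_def mult.assoc[symmetric] del: mult_fract inverse_fract)
  have "?b * (f * \<eta> I) = f * m I" for I
    unfolding m by (simp only: mult_ac)
  then show "simple_pole_at A \<alpha> (chart_forms \<eta>) q"
    using fm by (intro simple_poleI[OF q b hom]) (simp only:)
  \<comment> \<open>Since \<open>m = b \<eta>\<close>, the product rule expresses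
    \<open>b ^ 2 f d\<eta>\<close> as \<open>b d(f m) - b df\<close> wedge \<open>m\<close> minus
    \<open>db\<close> wedge \<open>f m\<close>, and all three are polynomial.\<close>
  have "rat_of_poly (b ^ 2) * (f * ext_deriv rat_pderiv \<eta> I) \<in> range rat_of_poly" for I
  proof -
    have "rat_of_poly (b ^ 2) * (f * (sign_at i I * rat_pderiv i (\<eta> J))) =
        ?b * (sign_at i I * rat_pderiv i (f * m J)) - ?b * (sign_at i I * rat_pderiv i f * m J)
        - sign_at i I * rat_pderiv i ?b * (f * m J)" for i J
      unfolding m rat_of_poly_power
      by (simp add: rat_pderiv_mult algebra_simps power2_eq_square del: mult_fract add_fract)
    then have "rat_of_poly (b ^ 2) * (f * ext_deriv rat_pderiv \<eta> I) =
        (\<Sum>i\<in>I. ?b * (sign_at i I * rat_pderiv i (f * m (I - {i})))) - ?b * dform_mult f m I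
        - (\<Sum>i\<in>I. sign_at i I * rat_pderiv i ?b * (f * m (I - {i})))"
      unfolding ext_deriv_def one_form_mult_def sum_distrib_left sum_subtractf[symmetric]
      by (simp only:)
    also have "\<dots> \<in> range rat_of_poly"
      by (intro poly_range_diff poly_range_sum poly_range_mult[OF _ fm]
          poly_range_mult[OF rangeI df_mult_log_form[OF log]] poly_range_mult[OF rangeI]
          poly_range_mult[OF poly_range_sign_at] poly_range_rat_pderiv rangeI fm)
    finally show ?thesis .
  qed
  then show "simple_pole_at A \<alpha> (pform_deriv (chart_forms \<eta>)) q"
    unfolding pform_deriv_chart_forms
    by (intro simple_poleI[OF q denominator_at_power[OF q b, of 2]] ext_deriv_homogeneous hom)
qed

section \<open>From simple poles back to fractions of logarithmic forms\<close>

lemma simple_pole_denominator: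
  assumes q: "q \<in> proj_space" and sp: "simple_pole_at A \<alpha> (chart_forms \<eta>) q"
    and k: "denominator_at q 1 (poly_X k)" and I: "k \<notin> I"
  shows "\<exists>d b. denominator_at q d b \<and> rat_of_poly b * (f * \<eta> I) \<in> range rat_of_poly"
proof -
  let ?g = "f / rat_X k ^ card A * (rat_X k ^ card I * \<eta> I)"
  have "?g \<in> local_ring q"
    using sp k I unfolding simple_pole_iff[OF q] by blast
  then obtain d b where b: "denominator_at q d b" "rat_of_poly b * ?g \<in> range rat_of_poly"
    by (rule local_ring_denominator)
  \<comment> \<open>The power of \<open>x_k\<close> from the chart part joins the denominator, while
    the one from the local equation moves to the other side as a polynomial factor.\<close>
  have "rat_of_poly (b * poly_X k ^ card I) * (f * \<eta> I) = rat_X k ^ card A * (rat_of_poly b * ?g)"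
    by (simp add: rat_of_poly_mult rat_of_poly_power rat_X_def[symmetric] mult_ac del: mult_fract)
  then have "rat_of_poly (b * poly_X k ^ card I) * (f * \<eta> I) \<in> range rat_of_poly"
    by (simp only: poly_range_mult[OF _ b(2)] poly_range_power poly_range_rat_X)
  then show ?thesis
    using denominator_at_mult[OF q b(1) denominator_at_power[OF q k]] by blast
qed

text \<open>
  \<open>df \<and> \<nu>\<close> is divisible by \<open>f\<close>, hence by \<open>\<alpha>\<^sub>H\<close>; modulo \<open>\<alpha>\<^sub>H\<close> it equals
  \<open>(f/\<alpha>\<^sub>H) d\<alpha>\<^sub>H \<and> \<nu>\<close>, and \<open>\<alpha>\<^sub>H\<close> is prime and does not divide \<open>f/\<alpha>\<^sub>H\<close>.
\<close>

lemma alpha_divides: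
  assumes H: "H \<in> A" and \<nu>: "\<And>i. i \<in> I \<Longrightarrow> \<nu> (I - {i}) \<in> range rat_of_poly"
    and df: "inverse f * dform_mult f \<nu> I \<in> range rat_of_poly"
  shows "inverse (a H) * dform_mult (a H) \<nu> I \<in> range rat_of_poly"
proof -
  define g where "g = (\<Prod>H'\<in>A - {H}. \<alpha> H')"
  let ?g = "rat_of_poly g"
  have f: "f = a H * ?g"
    unfolding defining_poly_def g_def rat_of_poly_mult[symmetric]
    using finite_A H by (subst prod.remove[of A H]) auto
  have aH: "a H \<noteq> 0"
    using H by simp
  have nd: "\<not> \<alpha> H dvd g"
    unfolding g_def using H finite_A alpha_not_dvd
    by (intro linear_form_not_dvd_prod alpha_homogeneous alpha_nonzero) auto
  have df_split: "dform_mult f \<nu> I = ?g * dform_mult (a H) \<nu> I + a H * dform_mult ?g \<nu> I"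
    unfolding f one_form_mult_def sum_distrib_left sum.distrib[symmetric] rat_pderiv_mult
    by (intro sum.cong refl) (simp only: algebra_simps)
  have poly: "dform_mult (rat_of_poly h) \<nu> I \<in> range rat_of_poly" for h
    unfolding one_form_mult_def
    by (intro poly_range_sum poly_range_mult[OF poly_range_mult] poly_range_sign_at
        poly_range_rat_pderiv rangeI \<nu>)
  obtain u v w where u: "dform_mult (a H) \<nu> I = rat_of_poly u" and v: "dform_mult ?g \<nu> I = rat_of_poly v"
    and w: "inverse f * dform_mult f \<nu> I = rat_of_poly w"
    using poly[of "\<alpha> H"] poly[of g] df by blast
  have "dform_mult f \<nu> I = f * (inverse f * dform_mult f \<nu> I)"
    by (simp add: mult.assoc[symmetric] del: mult_fract inverse_fract)
  then have "f * rat_of_poly w = ?g * rat_of_poly u + a H * rat_of_poly v"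
    using df_split unfolding u v w by simp
  then have "rat_of_poly (g * u) = rat_of_poly (\<alpha> H * (g * w - v))"
    unfolding f rat_of_poly_mult rat_of_poly_diff by (simp only: algebra_simps)
  then have "g * u = \<alpha> H * (g * w - v)"
    by (simp only: rat_of_poly_eq_iff)
  then have "\<alpha> H dvd g * u"
    by (metis dvd_triv_left)
  then obtain t where t: "u = \<alpha> H * t"
    using prime_linear_form[OF alpha_homogeneous[OF H] alpha_nonzero[OF H]] nd by (auto simp: dvd_def)
  have "inverse (a H) * dform_mult (a H) \<nu> I = rat_of_poly t"
    unfolding u t rat_of_poly_mult mult.assoc[symmetric] left_inverse[OF aH] by (rule mult_1)
  then show ?thesis
    by (rule range_eqI)
qed

text \<open>The converse of \<open>fraction_simple_poles\<close>. One denominator \<open>b\<close>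
  is found for the coefficients of \<eta> and d\<eta> off \<open>k\<close>, the condition for each
  hyperplane is derived there, and the contraction then supplies the index sets containing
  \<open>k\<close>.\<close>

lemma simple_poles_fraction:
  assumes q: "q \<in> proj_space" and \<eta>: "\<eta> \<in> basic_forms p"
    and sp: "simple_pole_at A \<alpha> (chart_forms \<eta>) q"
    and spd: "simple_pole_at A \<alpha> (pform_deriv (chart_forms \<eta>)) q"
  obtains d b where "denominator_at q d b" "scale_form (rat_of_poly b) \<eta> \<in> log_forms0_deg A \<alpha> p (int d)"
proof -
  have euler: "euler_contraction \<eta> = 0"
    and hom: "homogeneous_rat (- int (card I)) (\<eta> I)"
    and deg: "card I \<noteq> p \<Longrightarrow> \<eta> I = 0" for I
    using \<eta> by (auto simp: basic_forms_def)
  obtain k where k: "denominator_at q 1 (poly_X k)"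
    using denominator_at_X[OF q] .
  obtain d b where b: "denominator_at q d b"
    and b_all: "\<forall>x\<in>{\<eta>, ext_deriv rat_pderiv \<eta>} \<times> {I. k \<notin> I}.
      rat_of_poly b * (f * fst x (snd x)) \<in> range rat_of_poly"
    using common_denominator[OF q, of "{\<eta>, ext_deriv rat_pderiv \<eta>} \<times> {I. k \<notin> I}" "\<lambda>x. f * fst x (snd x)"]
      simple_pole_denominator[OF q sp k] simple_pole_denominator[OF q spd[unfolded pform_deriv_chart_forms] k]
    by fastforce
  let ?b = "rat_of_poly b" and ?x = "rat_X k"
  have b\<eta>: "?b * (f * \<eta> I) \<in> range rat_of_poly"
    and bd\<eta>: "?b * (f * ext_deriv rat_pderiv \<eta> I) \<in> range rat_of_poly" if "k \<notin> I" for I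
    using b_all that by (auto simp del: mult_fract)
  \<comment> \<open>The factor \<open>f\<close> together with one \<open>b\<close> would already
    make the coefficients off \<open>k\<close> polynomial. The second \<open>b\<close> is reserved
    for the derivatives of \<open>f * \<eta> I\<close> in the next step.\<close>
  define \<nu> where "\<nu> = scale_form (?b\<^sup>2 * f) \<eta>"
  have \<nu>: "\<nu> I \<in> range rat_of_poly" if "k \<notin> I" for I
  proof -
    have "\<nu> I = ?b * (?b * (f * \<eta> I))"
      by (simp only: \<nu>_def scale_form_def power2_eq_square mult_ac)
    then show ?thesis
      by (simp only: poly_range_mult[OF rangeI b\<eta>[OF that]])
  qed
  have df: "inverse f * dform_mult f \<nu> I \<in> range rat_of_poly" if I: "k \<notin> I" for I
  proof -
    have "inverse f * (sign_at i I * rat_pderiv i f * \<nu> J) =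
        sign_at i I * (?b\<^sup>2 * rat_pderiv i (f * \<eta> J)) - ?b * (?b * (f * (sign_at i I * rat_pderiv i (\<eta> J))))"
      for i J
    proof -
      have "inverse f * (sign_at i I * rat_pderiv i f * \<nu> J) =
          (inverse f * f) * (sign_at i I * rat_pderiv i f * ?b\<^sup>2 * \<eta> J)"
        by (simp only: \<nu>_def scale_form_def mult_ac)
      also have "\<dots> = sign_at i I * rat_pderiv i f * ?b\<^sup>2 * \<eta> J"
        by (simp only: left_inverse[OF f_nonzero] mult_1)
      finally show ?thesis
        by (simp only: rat_pderiv_mult algebra_simps power2_eq_square)
    qed
    then have "inverse f * dform_mult f \<nu> I =
        (\<Sum>i\<in>I. sign_at i I * (?b\<^sup>2 * rat_pderiv i (f * \<eta> (I - {i})))) -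
        ?b * (?b * (f * ext_deriv rat_pderiv \<eta> I))"
      unfolding ext_deriv_def one_form_mult_def sum_distrib_left sum_subtractf[symmetric]
      by (simp only:)
    also have "\<dots> \<in> range rat_of_poly"
      by (intro poly_range_diff poly_range_sum poly_range_mult[OF poly_range_sign_at]
          poly_range_square_mult_pderiv poly_range_mult[OF rangeI bd\<eta>] rangeI b\<eta>)
        (use I in auto)
    finally show ?thesis .
  qed
  have euler_\<nu>: "euler_contraction \<nu> = 0"
  proof -
    have "euler_contraction \<nu> = scale_form (?b\<^sup>2 * f) (euler_contraction \<eta>)"
      by (simp only: \<nu>_def euler_contraction_def scale_form_def sum_distrib_left mult_ac)
    then show ?thesis
      by (simp add: euler scale_form_def fun_eq_iff)
  qed
  \<comment> \<open>The factor 1 is the multiplier of \<open>euler_solve_range\<close>: off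
    \<open>k\<close> the form \<nu> itself is polynomial and its contraction is zero.\<close>
  have x\<nu>: "?x * (1 * \<nu> I) \<in> range rat_of_poly" for I
  proof (cases "k \<in> I")
    case True
    then show ?thesis
      by (intro euler_solve_range) (auto simp: euler_\<nu> intro!: \<nu>)
  next
    case False
    then show ?thesis
      by (intro poly_range_mult poly_range_rat_X poly_range_1 \<nu>)
  qed
  have x\<alpha>: "?x * (inverse (a H) * dform_mult (a H) \<nu> I) \<in> range rat_of_poly" if H: "H \<in> A" for H I
  proof -
    have off: "inverse (a H) * dform_mult (a H) \<nu> J \<in> range rat_of_poly" if "k \<notin> J" for J
      using that by (intro alpha_divides H \<nu> df) auto
    show ?thesis
    proof (cases "k \<in> I")
      case True
      \<comment> \<open>By the antiderivation rule and Euler's identity, the contraction of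
        d\<alpha> wedge \<nu> is \<alpha>\<nu>. Dividing by \<alpha> leaves a coefficient of \<nu>
        at \<open>I - {k}\<close>, which is polynomial, so \<open>euler_solve_range\<close> applies
        with multiplier \<open>inverse (a H)\<close>.\<close>
      have "(\<Sum>i\<in>UNIV. rat_X i * rat_pderiv i (a H)) = rat_of_poly (\<Sum>i\<in>UNIV. poly_X i * poly_pderiv i (\<alpha> H))"
        by (simp only: rat_of_poly_sum rat_of_poly_mult rat_X_def rat_pderiv_poly)
      then have "(\<Sum>i\<in>UNIV. rat_X i * rat_pderiv i (a H)) = a H"
        by (simp only: euler_linear_form[OF alpha_homogeneous[OF H]])
      then have "euler_contraction (dform_mult (a H) \<nu>) (I - {k}) = a H * \<nu> (I - {k})"
        by (simp only: euler_contraction_one_form_mult euler_\<nu> one_form_mult_zero zero_fun_apply diff_zero)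
      then have "inverse (a H) * euler_contraction (dform_mult (a H) \<nu>) (I - {k}) = \<nu> (I - {k})"
        by (simp only: mult.assoc[symmetric] left_inverse[OF a_nonzero[OF H]] mult_1)
      moreover have "\<nu> (I - {k}) \<in> range rat_of_poly"
        by (rule \<nu>) simp
      ultimately show ?thesis
        using True by (intro euler_solve_range off) (auto simp del: inverse_fract mult_fract)
    next
      case False
      then show ?thesis
        by (intro poly_range_mult[OF poly_range_rat_X] off)
    qed
  qed
  \<comment> \<open>\<open>b ^ 2\<close> is inherited from \<nu> and \<open>x_k\<close> from solving
    the contraction, whence the degree \<open>2 * d + 1\<close>. Clearing \<open>f\<close> from
    \<open>c \<eta>\<close> gives \<open>x_k \<nu>\<close>.\<close>
  define c where "c = b ^ 2 * poly_X k"
  let ?m = "scale_form (rat_of_poly c) \<eta>"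
  have c: "denominator_at q (2 * d + 1) c"
    unfolding c_def by (intro denominator_at_mult denominator_at_power q b k)
  have m: "f * ?m I = ?x * (1 * \<nu> I)" for I
    unfolding c_def rat_of_poly_mult rat_of_poly_power \<nu>_def scale_form_def rat_X_def
    by (simp only: mult_ac mult_1)
  have dm: "f * (inverse (a H) * dform_mult (a H) ?m I) =
      ?x * (inverse (a H) * dform_mult (a H) \<nu> I)" for H I
  proof -
    have "f * (inverse (a H) * dform_mult (a H) ?m I) =
        (\<Sum>i\<in>I. inverse (a H) * (sign_at i I * rat_pderiv i (a H) * (f * ?m (I - {i}))))"
      by (simp only: one_form_mult_def sum_distrib_left mult_ac)
    also have "\<dots> = ?x * (inverse (a H) * dform_mult (a H) \<nu> I)"
      unfolding m by (simp only: one_form_mult_def sum_distrib_left mult_ac mult_1)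
    finally show ?thesis .
  qed
  have "?m \<in> log_forms A \<alpha> p"
    unfolding log_forms_iff m dm using x\<nu> x\<alpha> deg by (simp add: scale_form_def)
  moreover have "euler_contraction ?m = 0"
  proof -
    have "euler_contraction ?m = scale_form (rat_of_poly c) (euler_contraction \<eta>)"
      by (simp only: euler_contraction_def scale_form_def sum_distrib_left mult_ac)
    then show ?thesis
      by (simp add: euler scale_form_def fun_eq_iff)
  qed
  moreover have "homogeneous_rat (int (2 * d + 1) - int (card I)) (?m I)" for I
    unfolding scale_form_def diff_conv_add_uminus
    by (intro homogeneous_rat_mult homogeneous_rat_poly hom) (use c in \<open>simp add: denominator_at_def\<close>)
  ultimately have "?m \<in> log_forms0_deg A \<alpha> p (int (2 * d + 1))"
    by (simp add: log_forms0_deg_def log_forms0_def)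
  then show ?thesis
    using that c by blast
qed

end

section \<open>Comparison of the sheaves\<close>

lemma zariski_open_subset: "zariski_open U \<Longrightarrow> U \<subseteq> proj_space"
  by (auto simp: zariski_open_def)

text \<open>Multiplying all defining polynomials of \<open>W\<close> by \<open>b\<close> cuts out
  the smaller set, as vanishing at a point is multiplicative on homogeneous polynomials.\<close>

lemma zariski_open_basic:
  assumes "zariski_open W" "homogeneous_poly d b"
  shows "zariski_open {q \<in> W. \<not> vanishes_at b q}"
proof -
  obtain S where S: "\<And>c. c \<in> S \<Longrightarrow> \<exists>e. homogeneous_poly e c"
    "W = {q \<in> proj_space. \<exists>c\<in>S. \<not> vanishes_at c q}"
    using assms(1) unfolding zariski_open_def by blast
  have "vanishes_at (b * c) q \<longleftrightarrow> vanishes_at b q \<or> vanishes_at c q" if "q \<in> proj_space" "c \<in> S" for c q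
    using S(1)[OF that(2)] vanishes_at_mult[OF that(1) assms(2)] by blast
  then have "{q \<in> W. \<not> vanishes_at b q} = {q \<in> proj_space. \<exists>c\<in>(*) b ` S. \<not> vanishes_at c q}"
    unfolding S(2) by auto
  moreover have "\<forall>c\<in>(*) b ` S. \<exists>e. homogeneous_poly e c"
    using S(1) homogeneous_poly_mult[OF assms(2)] by blast
  ultimately show ?thesis
    unfolding zariski_open_def by blast
qed

context central_arrangement
begin

lemma proj_log_sheaf_rational:
  "s \<in> proj_log_sheaf A \<alpha> p U \<Longrightarrow> q \<in> U \<Longrightarrow> s q \<in> rational_pforms p"
  unfolding proj_log_sheaf_def by fastforce

text \<open>Poles are inspected at \<open>q\<close> alone. The fraction found there is an identity
  between rational forms, so it serves at every point of \<open>W\<close> where \<open>b\<close>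
  does not vanish.\<close>

lemma pullback_sections_image:
  assumes U: "zariski_open U" and s: "s \<in> proj_log_sheaf A \<alpha> p U"
  shows "pullback_sections U s \<in> associated_sheaf scale_form (log_forms0_deg A \<alpha> p) U"
proof -
  have "\<exists>W m b d. zariski_open W \<and> q \<in> W \<and> W \<subseteq> U \<and> m \<in> log_forms0_deg A \<alpha> p (int d) \<and>
      homogeneous_poly d b \<and> (\<forall>q'\<in>W. \<not> vanishes_at b q' \<and>
        pullback_sections U s q' = scale_form (inverse (rat_of_poly b)) m)" if q: "q \<in> U" for q
  proof -
    obtain W \<omega> where W: "\<omega> \<in> rational_pforms p" "zariski_open W" "q \<in> W" "W \<subseteq> U"
      and s_eq: "\<And>q'. q' \<in> W \<Longrightarrow> s q' = \<omega>"
      and sp: "simple_pole_at A \<alpha> \<omega> q" "simple_pole_at A \<alpha> (pform_deriv \<omega>) q"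
      using s q unfolding proj_log_sheaf_def by blast
    let ?\<eta> = "pullback_form \<omega>"
    have \<omega>: "chart_forms ?\<eta> = \<omega>"
      by (rule chart_forms_pullback_form[OF W(1)])
    obtain d b where b: "denominator_at q d b" "scale_form (rat_of_poly b) ?\<eta> \<in> log_forms0_deg A \<alpha> p (int d)"
      using simple_poles_fraction[of q ?\<eta> p] zariski_open_subset[OF U] q pullback_form_basic[OF W(1)] sp
      unfolding \<omega> by blast
    have b': "homogeneous_poly d b" "\<not> vanishes_at b q" "rat_of_poly b \<noteq> 0"
      using b(1) denominator_at_nonzero[OF b(1)] by (auto simp: denominator_at_def rat_of_poly_eq_0_iff)
    have "scale_form (inverse (rat_of_poly b)) (scale_form (rat_of_poly b) ?\<eta>) = ?\<eta>"
      by (simp only: scale_form_def mult.assoc[symmetric] left_inverse[OF b'(3)] mult_1)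
    moreover have "pullback_sections U s q' = ?\<eta>" if "q' \<in> W" for q'
      using that W(4) s_eq by (auto simp: pullback_sections_def)
    ultimately show ?thesis
      using zariski_open_basic[OF W(2) b'(1)] W b' b(2)
      by (intro exI[of _ "{q \<in> W. \<not> vanishes_at b q}"] exI[of _ "scale_form (rat_of_poly b) ?\<eta>"]
          exI[of _ b] exI[of _ d]) auto
  qed
  then show ?thesis
    by (auto simp: associated_sheaf_def pullback_sections_def)
qed

lemma pullback_sections_inj:
  "inj_on (pullback_sections U) (proj_log_sheaf A \<alpha> p U)"
proof (rule inj_onI)
  fix s t
  assume s: "s \<in> proj_log_sheaf A \<alpha> p U" and t: "t \<in> proj_log_sheaf A \<alpha> p U"
    and eq: "pullback_sections U s = pullback_sections U t"
  show "s = t"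
  proof (rule extensionalityI)
    fix q assume q: "q \<in> U"
    then have "pullback_form (s q) = pullback_form (t q)"
      using fun_cong[OF eq, of q] by (simp add: pullback_sections_def)
    then show "s q = t q"
      using chart_forms_pullback_form proj_log_sheaf_rational[OF s q] proj_log_sheaf_rational[OF t q]
      by metis
  qed (use s t in \<open>auto simp: proj_log_sheaf_def\<close>)
qed

text \<open>The preimage takes chart parts germ by germ. Where \<open>t\<close> equals one fraction
  \<open>m/b\<close>, this is a single rational form, and \<open>b\<close> is an admissible
  denominator at each point of that open set.\<close>

lemma pullback_sections_surj:
  assumes U: "zariski_open U" and t: "t \<in> associated_sheaf scale_form (log_forms0_deg A \<alpha> p) U"
  shows "t \<in> pullback_sections U ` proj_log_sheaf A \<alpha> p U"
proof -
  define s where "s = (\<lambda>q\<in>U. chart_forms (t q))"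
  have ex: "\<exists>W m b d. zariski_open W \<and> q \<in> W \<and> W \<subseteq> U \<and> m \<in> log_forms0_deg A \<alpha> p (int d) \<and>
      homogeneous_poly d b \<and> (\<forall>q'\<in>W. \<not> vanishes_at b q' \<and>
        t q' = scale_form (inverse (rat_of_poly b)) m)" if "q \<in> U" for q
    using t that unfolding associated_sheaf_def by blast
  have "\<exists>W. \<exists>\<omega>\<in>rational_pforms p. zariski_open W \<and> q \<in> W \<and> W \<subseteq> U \<and>
      (\<forall>q'\<in>W. s q' = \<omega> \<and> simple_pole_at A \<alpha> \<omega> q' \<and> simple_pole_at A \<alpha> (pform_deriv \<omega>) q')"
    if q: "q \<in> U" for q
  proof -
    obtain W m b d where W: "zariski_open W" "q \<in> W" "W \<subseteq> U" and m: "m \<in> log_forms0_deg A \<alpha> p (int d)"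
      and b: "homogeneous_poly d b"
      and t_eq: "\<And>q'. q' \<in> W \<Longrightarrow> \<not> vanishes_at b q' \<and> t q' = scale_form (inverse (rat_of_poly b)) m"
      using ex[OF q] by blast
    let ?\<eta> = "scale_form (inverse (rat_of_poly b)) m"
    have "chart_forms ?\<eta> \<in> rational_pforms p"
      by (rule chart_forms_rational[OF fraction_basic[OF m b]])
    moreover have "s q' = chart_forms ?\<eta>" if "q' \<in> W" for q'
      using that W(3) t_eq[OF that] by (auto simp: s_def simp del: inverse_fract)
    moreover have "simple_pole_at A \<alpha> (chart_forms ?\<eta>) q' \<and>
        simple_pole_at A \<alpha> (pform_deriv (chart_forms ?\<eta>)) q'" if "q' \<in> W" for q'
      using fraction_simple_poles[OF _ m, of q' b] that t_eq[OF that] b zariski_open_subset[OF W(1)]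
      by (auto simp: denominator_at_def simp del: inverse_fract)
    ultimately show ?thesis
      using W by blast
  qed
  then have "s \<in> proj_log_sheaf A \<alpha> p U"
    by (auto simp: proj_log_sheaf_def s_def)
  moreover have "pullback_sections U s = t"
  proof (rule extensionalityI)
    fix q assume q: "q \<in> U"
    then obtain m b d where "m \<in> log_forms0_deg A \<alpha> p (int d)" "homogeneous_poly d b"
        "t q = scale_form (inverse (rat_of_poly b)) m"
      using ex[OF q] by blast
    then have "euler_contraction (t q) = 0"
      using fraction_basic[of m p d b] by (simp add: basic_forms_def del: inverse_fract)
    then show "pullback_sections U s q = t q"
      using q by (simp add: pullback_sections_def s_def pullback_form_chart_forms)
  qed (use t in \<open>auto simp: pullback_sections_def associated_sheaf_def\<close>)
  ultimately show ?thesis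
    by blast
qed

text \<open>Sections are functions to germs, and pullback is linear over the function field. Sums,
  multiples and restrictions are therefore compared point by point.\<close>

lemma pullback_sections_iso:
  "module_sheaf_iso structure_sheaf scale_pform (proj_log_sheaf A \<alpha> p)
     scale_form (associated_sheaf scale_form (log_forms0_deg A \<alpha> p)) pullback_sections"
  unfolding module_sheaf_iso_def
proof (intro allI impI conjI ballI)
  fix U :: "'n ppoint set" assume U: "zariski_open U"
  show "bij_betw (pullback_sections U) (proj_log_sheaf A \<alpha> p U)
      (associated_sheaf scale_form (log_forms0_deg A \<alpha> p) U)"
    using pullback_sections_inj pullback_sections_image[OF U] pullback_sections_surj[OF U]
    by (auto simp: bij_betw_def)
next
  fix U s t assume s: "s \<in> proj_log_sheaf A \<alpha> p U" and t: "t \<in> proj_log_sheaf A \<alpha> p U"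
  show "pullback_sections U (\<lambda>q\<in>U. s q + t q) = (\<lambda>q\<in>U. pullback_sections U s q + pullback_sections U t q)"
    unfolding pullback_sections_def
    by (rule restrict_ext)
      (simp add: pullback_form_add[OF proj_log_sheaf_rational[OF s] proj_log_sheaf_rational[OF t]])
next
  fix U c s assume s: "s \<in> proj_log_sheaf A \<alpha> p U"
  show "pullback_sections U (\<lambda>q\<in>U. scale_pform (c q) (s q)) =
      (\<lambda>q\<in>U. scale_form (c q) (pullback_sections U s q))"
    unfolding pullback_sections_def
    by (rule restrict_ext) (simp add: pullback_form_scale[OF proj_log_sheaf_rational[OF s]])
next
  fix U W s assume "zariski_open W \<and> W \<subseteq> U \<and> s \<in> proj_log_sheaf A \<alpha> p U"
  then show "pullback_sections W (restrict s W) = restrict (pullback_sections U s) W"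
    by (intro extensionalityI[of _ W]) (auto simp: pullback_sections_def)
qed

end

theorem proposition2p12:
  fixes A :: "'n::{finite,linorder} cspace set set"
    and \<alpha> :: "'n cspace set \<Rightarrow> 'n cpoly"
    and p :: nat
  assumes "central_essential_arrangement A"
    and "defining_forms A \<alpha>"
  shows "module_sheaf_iso structure_sheaf
    scale_pform (proj_log_sheaf A \<alpha> p)
    scale_form (associated_sheaf scale_form (log_forms0_deg A \<alpha> p))
    pullback_sections"
proof -
  interpret central_arrangement A \<alpha>
    using assms by unfold_locales (auto simp: central_essential_arrangement_def)
  show ?thesis
    by (rule pullback_sections_iso)
qed

end
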